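(* Let $n\ge 3$ and let $F_n^1$ be the complex Leibniz algebra with basis $\{e_1,\dots,e_n\}$ and $[e_1,e_1]=e_3$, $[e_i,e_1]=e_{i+1}$ for $2\le i\le n-1$. An arbitrary three-dimensional non-split central extension of $F_n^1$ is isomorphic to one of the following pairwise non-isomorphic algebras (each with basis $\{e_1,\dots,e_{n+3}\}$): - $P(0,0,0)$, $P(1,0,0)$, $P(0,0,1)$, $P(1,0,1)$, $P(0,0,2)$, $P(1,0,2)$, $P(0,1,\gamma_4)$ with $\gamma_4\ne1$, $P(0,2,1)$, $P(0,2,2)$, $P(0,1,1)$, where $$P(\alpha_4,\beta_4,\gamma_4):\left\{\begin{array}{ll}[e_i,e_1]=e_{i+1},&1\le i\le n-1,\\ [e_{n+1},e_1]=e_2+e_{n+2},&\\ [e_1,e_{n+1}]=e_{n+3},&\\ [e_{n+1},e_{n+1}]=\alpha_4e_n+\beta_4e_{n+2}+\gamma_4e_{n+3};&\end{array}\right.$$ - $$P^*:\left\{\begin{array}{ll}[e_i,e_1]=e_{i+1},&1\le i\le n-2,\\ [e_n,e_1]=e_2+e_{n+1},&\\ [e_1,e_n]=e_{n+2},&\\ [e_n,e_n]=e_{n+3}.&\end{array}\right.$$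
   Context: All vector spaces and algebras are finite-dimensional over $\mathbb{C}$; parameters are complex numbers; in multiplication tables omitted products of basis elements are zero. A Leibniz algebra is an algebra $L$ with bilinear product satisfying $[x,[y,z]]=[[x,y],z]-[[x,z],y]$. A $k$-dimensional central extension of a Leibniz algebra $L$ is a Leibniz algebra $\widehat L$ fitting into a short exact sequence of Leibniz algebras $0\to V\to\widehat L\to L\to0$ with $\dim V=k$ and the image of $V$ contained in the center of $\widehat L$; equivalently $\widehat L\cong L\oplus V$ with product $[x+u,y+v]=[x,y]_L+\theta(x,y)$, where $\theta:L\times L\to V$ is bilinear with $\theta(x,[y,z])=\theta([x,y],z)-\theta([x,z],y)$. A $k$-dimensional central extension of $L$ is split if, as an algebra, it is isomorphic to $L'\oplus\mathbb{C}$, where $L'$ is a $(k-1)$-dimensional central extension of $L$ and $\mathbb{C}$ is the one-dimensional abelian algebra; otherwise it is non-split. *)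

theory Defs
  imports Complex_Main "HOL-Library.Function_Algebras" "HOL-Library.Product_Plus"
begin

text \<open>
  A complex algebra is carried by a subspace of an ambient complex vector space, so that
  dimensions may depend on natural numbers. Only the restriction of the bracket to the carrier
  matters.
\<close>

record 'a calg =
  smul :: "complex \<Rightarrow> 'a \<Rightarrow> 'a"
  carr :: "'a set"
  bracket :: "'a \<Rightarrow> 'a \<Rightarrow> 'a"

locale leibniz_algebra = vector_space "smul A" for A :: "'a::ab_group_add calg" +
  assumes carr_subspace: "subspace (carr A)"
    and finite_dimensional: "\<exists>B. finite B \<and> span B = carr A"
    and bracket_closed: "\<lbrakk>x \<in> carr A; y \<in> carr A\<rbrakk> \<Longrightarrow> bracket A x y \<in> carr A"
    and bracket_add_left: "\<lbrakk>x \<in> carr A; y \<in> carr A; z \<in> carr A\<rbrakk> \<Longrightarrow>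
      bracket A (x + y) z = bracket A x z + bracket A y z"
    and bracket_add_right: "\<lbrakk>x \<in> carr A; y \<in> carr A; z \<in> carr A\<rbrakk> \<Longrightarrow>
      bracket A x (y + z) = bracket A x y + bracket A x z"
    and bracket_smul_left: "\<lbrakk>x \<in> carr A; y \<in> carr A\<rbrakk> \<Longrightarrow>
      bracket A (smul A c x) y = smul A c (bracket A x y)"
    and bracket_smul_right: "\<lbrakk>x \<in> carr A; y \<in> carr A\<rbrakk> \<Longrightarrow>
      bracket A x (smul A c y) = smul A c (bracket A x y)"
    and leibniz: "\<lbrakk>x \<in> carr A; y \<in> carr A; z \<in> carr A\<rbrakk> \<Longrightarrow>
      bracket A x (bracket A y z) =
        bracket A (bracket A x y) z - bracket A (bracket A x z) y"

definition alg_hom ::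
  "'a::ab_group_add calg \<Rightarrow> 'b::ab_group_add calg \<Rightarrow> ('a \<Rightarrow> 'b) \<Rightarrow> bool" where
  "alg_hom A B f \<longleftrightarrow>
    (\<forall>x\<in>carr A. f x \<in> carr B) \<and>
    (\<forall>x\<in>carr A. \<forall>y\<in>carr A. f (x + y) = f x + f y) \<and>
    (\<forall>c. \<forall>x\<in>carr A. f (smul A c x) = smul B c (f x)) \<and>
    (\<forall>x\<in>carr A. \<forall>y\<in>carr A. f (bracket A x y) = bracket B (f x) (f y))"

definition alg_isomorphic ::
  "'a::ab_group_add calg \<Rightarrow> 'b::ab_group_add calg \<Rightarrow> bool" (infix "\<cong>\<^sub>a" 50) where
  "A \<cong>\<^sub>a B \<longleftrightarrow> (\<exists>f. alg_hom A B f \<and> bij_betw f (carr A) (carr B))"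

definition alg_center :: "'a::ab_group_add calg \<Rightarrow> 'a set" where
  "alg_center A = {z \<in> carr A. \<forall>x\<in>carr A. bracket A x z = 0 \<and> bracket A z x = 0}"

definition short_exact ::
  "'v::ab_group_add calg \<Rightarrow> ('v \<Rightarrow> 'e) \<Rightarrow> 'e::ab_group_add calg \<Rightarrow> ('e \<Rightarrow> 'l)
    \<Rightarrow> 'l::ab_group_add calg \<Rightarrow> bool" where
  "short_exact V \<iota> E \<pi> L \<longleftrightarrow>
    alg_hom V E \<iota> \<and> alg_hom E L \<pi> \<and> inj_on \<iota> (carr V) \<and>
    \<iota> ` carr V = {x \<in> carr E. \<pi> x = 0} \<and> \<pi> ` carr E = carr L"

text \<open>
  Since one cannot quantify over types inside a formula, algebras whose existence is asserted
  (the kernel \<open>V\<close> here and the smaller extension in the definition of split below) live in the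
  ambient space \<open>nat \<Rightarrow> complex\<close>. This is no restriction, because every finite-dimensional
  complex algebra is isomorphic to one of these.
\<close>

definition central_extension ::
  "nat \<Rightarrow> 'e::ab_group_add calg \<Rightarrow> 'l::ab_group_add calg \<Rightarrow> bool" where
  "central_extension k E L \<longleftrightarrow>
    leibniz_algebra E \<and> leibniz_algebra L \<and>
    (\<exists>(V :: (nat \<Rightarrow> complex) calg) \<iota> \<pi>.
      leibniz_algebra V \<and> vector_space.dim (smul V) (carr V) = k \<and>
      short_exact V \<iota> E \<pi> L \<and> \<iota> ` carr V \<subseteq> alg_center E)"

definition direct_sum ::
  "'a::ab_group_add calg \<Rightarrow> 'b::ab_group_add calg \<Rightarrow> ('a \<times> 'b) calg" where
  "direct_sum A B =
    \<lparr>smul = (\<lambda>c x. (smul A c (fst x), smul B c (snd x))),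
     carr = carr A \<times> carr B,
     bracket = (\<lambda>x y. (bracket A (fst x) (fst y), bracket B (snd x) (snd y)))\<rparr>"

definition abelian_line :: "complex calg" where
  "abelian_line = \<lparr>smul = (*), carr = UNIV, bracket = (\<lambda>x y. 0)\<rparr>"

definition split_extension ::
  "nat \<Rightarrow> 'e::ab_group_add calg \<Rightarrow> 'l::ab_group_add calg \<Rightarrow> bool" where
  "split_extension k E L \<longleftrightarrow>
    central_extension k E L \<and> 1 \<le> k \<and>
    (\<exists>L' :: (nat \<Rightarrow> complex) calg.
      central_extension (k - 1) L' L \<and> E \<cong>\<^sub>a direct_sum L' abelian_line)"

definition non_split_extension ::
  "nat \<Rightarrow> 'e::ab_group_add calg \<Rightarrow> 'l::ab_group_add calg \<Rightarrow> bool" where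
  "non_split_extension k E L \<longleftrightarrow> central_extension k E L \<and> \<not> split_extension k E L"

definition e :: "nat \<Rightarrow> nat \<Rightarrow> complex" where
  "e i = (\<lambda>k. if k = i then 1 else 0)"

definition cscale :: "complex \<Rightarrow> (nat \<Rightarrow> complex) \<Rightarrow> nat \<Rightarrow> complex" where
  "cscale c v = (\<lambda>k. c * v k)"

text \<open>
  The algebra with basis \<open>e 1, \<dots>, e m\<close> (coordinates outside \<open>{1..m}\<close> vanish) and multiplication
  table \<open>[e i, e j] = T i j\<close>.
\<close>

definition table_alg ::
  "nat \<Rightarrow> (nat \<Rightarrow> nat \<Rightarrow> nat \<Rightarrow> complex) \<Rightarrow> (nat \<Rightarrow> complex) calg" where
  "table_alg m T =
    \<lparr>smul = cscale,
     carr = {v. \<forall>k. k \<notin> {1..m} \<longrightarrow> v k = 0},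
     bracket = (\<lambda>x y. \<Sum>i=1..m. \<Sum>j=1..m. cscale (x i * y j) (T i j))\<rparr>"

definition F1 :: "nat \<Rightarrow> (nat \<Rightarrow> complex) calg" where
  "F1 n = table_alg n (\<lambda>i j.
    if i = 1 \<and> j = 1 then e 3
    else if 2 \<le> i \<and> i \<le> n - 1 \<and> j = 1 then e (i + 1)
    else 0)"

definition P :: "nat \<Rightarrow> complex \<Rightarrow> complex \<Rightarrow> complex \<Rightarrow> (nat \<Rightarrow> complex) calg" where
  "P n \<alpha> \<beta> \<gamma> = table_alg (n + 3) (\<lambda>i j.
    if 1 \<le> i \<and> i \<le> n - 1 \<and> j = 1 then e (i + 1)
    else if i = n + 1 \<and> j = 1 then e 2 + e (n + 2)
    else if i = 1 \<and> j = n + 1 then e (n + 3)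
    else if i = n + 1 \<and> j = n + 1 then
      cscale \<alpha> (e n) + cscale \<beta> (e (n + 2)) + cscale \<gamma> (e (n + 3))
    else 0)"

definition Pstar :: "nat \<Rightarrow> (nat \<Rightarrow> complex) calg" where
  "Pstar n = table_alg (n + 3) (\<lambda>i j.
    if 1 \<le> i \<and> i \<le> n - 2 \<and> j = 1 then e (i + 1)
    else if i = n \<and> j = 1 then e 2 + e (n + 1)
    else if i = 1 \<and> j = n then e (n + 2)
    else if i = n \<and> j = n then e (n + 3)
    else 0)"

definition P_params :: "(complex \<times> complex \<times> complex) set" where
  "P_params =
    {(0,0,0), (1,0,0), (0,0,1), (1,0,1), (0,0,2), (1,0,2)} \<union>
    {(0,1,\<gamma>) | \<gamma>. \<gamma> \<noteq> 1} \<union> {(0,2,1), (0,2,2), (0,1,1)}"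

end

theory Submission
  imports Defs
begin

text \<open>
  Write \<open>x\<close>, \<open>y\<close> for lifts of the two generators \<open>e 1\<close>, \<open>e 2\<close> of the algebra \<open>F1 n\<close> to a
  central extension \<open>E\<close> with kernel \<open>K\<close>, and \<open>[y x\<^sup>k]\<close> for the left-normed product of \<open>y\<close> with \<open>k\<close>
  factors \<open>x\<close>. The products
  \<open>w1 = [x,x] - [y,x]\<close>, \<open>w2 = [y x\<^sup>n\<^sup>-\<^sup>1]\<close>, \<open>w3 = [x,y]\<close>, \<open>w4 = [y,y]\<close>
  vanish in \<open>F1 n\<close>, so they lie in \<open>K\<close> and are central. The Leibniz identity and the centrality of
  \<open>w3\<close> and \<open>w4\<close> then determine all other products: right multiplication by an element of
  the derived algebra is zero, and \<open>y\<close> annihilates \<open>[y x\<^sup>k]\<close> from the right for \<open>k > 0\<close>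
  (\<open>bracket_chain\<close>, \<open>chain_bracket_y\<close>). Thus \<open>E\<close> is determined by the linear relations among the
  four elements \<open>w1, \<dots>, w4\<close>, which are the coordinates on the second cohomology of \<open>F1 n\<close>.

  If \<open>K\<close> is not contained in the derived algebra, a hyperplane that contains the derived algebra
  but misses some element of \<open>K\<close> is a complementary ideal, and the extension splits
  (\<open>non_split_extension_kernel\<close>). Hence in a non-split extension \<open>K\<close> is spanned by \<open>w1, \<dots>, w4\<close>; as
  \<open>K\<close> has dimension three there is one relation, a point of a projective 3-space
  (\<open>adapted_relation\<close>). Other choices of generators, \<open>x' = a x + b y + c [y x\<^sup>n\<^sup>-\<^sup>2]\<close> and
  \<open>y' = (a + b) y\<close>, act on these relations by an explicit formula (\<open>adapted_change\<close>): the condition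
  that \<open>[x',x'] - [y',x']\<close> is again central fixes the coefficient of \<open>y'\<close>. The algebra
  \<open>P n \<alpha> \<beta> \<gamma>\<close> is the one with relation \<open>w4 = \<alpha> w2 - \<beta> w1 + \<gamma> w3\<close>, and \<open>Pstar n\<close> the one with
  \<open>w2 = 0\<close>. Any relation other than \<open>w2 = 0\<close> can be moved to one that involves \<open>w4\<close>
  (\<open>relation_with_w4\<close>), and solving for the parameters of the change of generators brings
  \<open>(\<alpha>, \<beta>, \<gamma>)\<close> to an entry of the list (\<open>P_change_of_parameters\<close>).

  Conversely, an isomorphism between two of these algebras has to send the generators to elements of
  the same shape modulo the derived algebra. Comparing coordinates of \<open>[y,y]\<close> gives the
  same three equations between the parameters (\<open>P_isomorphic_params\<close>), and on the list these have
  only trivial solutions. The algebra \<open>Pstar n\<close> is told apart by its nilpotency: a left-normed product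
  of \<open>n\<close> equal factors vanishes there, whereas \<open>e n\<close> is such a product in \<open>P n \<alpha> \<beta> \<gamma>\<close>.
\<close>


section \<open>Linear algebra relative to a subspace\<close>

text \<open>
  Homomorphisms of algebras are only additive and homogeneous on the carrier, whereas the library
  speaks about maps that are linear on the whole type. A linear map that agrees with \<open>f\<close> on a basis
  of \<open>S\<close> agrees with \<open>f\<close> on all of \<open>S\<close>.
\<close>

lemma hom_on_subspace_dim:
  fixes s1 :: "'k::field \<Rightarrow> 'a::ab_group_add \<Rightarrow> 'a" and s2 :: "'k \<Rightarrow> 'b::ab_group_add \<Rightarrow> 'b"
  assumes "vector_space s1" "vector_space s2"
    and S: "module.subspace s1 S"
    and add: "\<And>x y. x \<in> S \<Longrightarrow> y \<in> S \<Longrightarrow> f (x + y) = f x + f y"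
    and scale: "\<And>c x. x \<in> S \<Longrightarrow> f (s1 c x) = s2 c (f x)"
    and inj: "inj_on f S"
  shows "vector_space.dim s2 (f ` S) = vector_space.dim s1 S"
proof -
  interpret V1: vector_space s1 by fact
  interpret V2: vector_space s2 by fact
  interpret vector_space_pair s1 s2 by unfold_locales
  obtain B where B: "B \<subseteq> S" "V1.independent B" "S \<subseteq> V1.span B" "card B = V1.dim S"
    using V1.basis_exists by blast
  have SB: "S = V1.span B"
    using B S by (simp add: V1.span_minimal subset_antisym)
  obtain h where h: "Vector_Spaces.linear s1 s2 h" "\<forall>x\<in>B. h x = f x"
    using linear_independent_extend[OF B(2)] by blast
  interpret h: Vector_Spaces.linear s1 s2 h by (rule h(1))
  have "V1.subspace {x \<in> S. h x = f x}"
  proof (rule V1.subspaceI)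
    have "f 0 = 0"
      using scale[OF V1.subspace_0[OF S], of 0] by simp
    then show "0 \<in> {x \<in> S. h x = f x}"
      using V1.subspace_0[OF S] by (simp add: h.zero)
  next
    fix x y assume "x \<in> {x \<in> S. h x = f x}" "y \<in> {x \<in> S. h x = f x}"
    then show "x + y \<in> {x \<in> S. h x = f x}"
      using V1.subspace_add[OF S] add by (simp add: h.add)
  next
    fix c x assume "x \<in> {x \<in> S. h x = f x}"
    then show "s1 c x \<in> {x \<in> S. h x = f x}"
      using V1.subspace_scale[OF S] scale by (simp add: h.scale)
  qed
  then have "V1.span B \<subseteq> {x \<in> S. h x = f x}"
    using B(1) h(2) by (intro V1.span_minimal) auto
  then have hf: "h x = f x" if "x \<in> S" for x
    using that SB by auto
  have "inj_on h (V1.span B)"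
    using inj hf SB by (metis inj_on_cong)
  then have ind: "V2.independent (h ` B)"
    using h.independent_injective_image[OF B(2)] by blast
  have "f ` S = h ` V1.span B"
    using hf SB by auto
  also have "\<dots> = V2.span (h ` B)"
    by (simp add: h.span_image)
  finally have "V2.dim (f ` S) = card (h ` B)"
    using ind V2.dim_span_eq_card_independent by simp
  also have "\<dots> = card B"
    using \<open>inj_on h (V1.span B)\<close> V1.span_superset by (metis card_image inj_on_subset)
  finally show ?thesis
    using B(4) by simp
qed

context vector_space
begin

text \<open>
  A maximal independent subset of the family spans \<open>I\<close>, so it has at least \<open>m\<close> elements and is the
  whole family. This is how the bases of extensions below are obtained: only generation is checked
  by hand, and independence follows by counting dimensions.
\<close>

lemma spanning_family_independent:
  fixes b :: "nat \<Rightarrow> 'b"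
  assumes "independent I" "I \<subseteq> span (b ` {1..m})" "m \<le> card I"
  shows "inj_on b {1..m}" "independent (b ` {1..m})"
proof -
  obtain B where B: "B \<subseteq> b ` {1..m}" "independent B" "b ` {1..m} \<subseteq> span B"
    using maximal_independent_subset by blast
  have "finite B" using B(1) by (meson finite_atLeastAtMost finite_imageI finite_subset)
  have "I \<subseteq> span B"
    using assms(2) B(3) by (metis span_mono span_span subset_trans)
  then have "card I \<le> card B"
    using independent_span_bound[OF \<open>finite B\<close> assms(1)] by blast
  then have mB: "m \<le> card B" using assms(3) by simp
  have "card (b ` {1..m}) \<le> m"
    using card_image_le[of "{1..m}" b] by simp
  then have BB: "B = b ` {1..m}"
    using mB B(1) card_seteq[of "b ` {1..m}" B] by simp
  then show "independent (b ` {1..m})" using B(2) by simp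
  show "inj_on b {1..m}"
    using mB BB \<open>card (b ` {1..m}) \<le> m\<close> by (intro eq_card_imp_inj_on) auto
qed

lemma independent_family_eq_0:
  fixes b :: "nat \<Rightarrow> 'b"
  assumes "inj_on b {1..m}" "independent (b ` {1..m})" "(\<Sum>i=1..m. c i *s b i) = 0" "i \<in> {1..m}"
  shows "c i = 0"
proof -
  let ?u = "\<lambda>v. c (inv_into {1..m} b v)"
  have "(\<Sum>v\<in>b ` {1..m}. ?u v *s v) = (\<Sum>i=1..m. c i *s b i)"
    using assms(1) by (simp add: sum.reindex)
  then have "?u (b i) = 0"
    using independentD[OF assms(2), of "b ` {1..m}" ?u "b i"] assms(3,4) by simp
  then show ?thesis using assms(1,4) by simp
qed

lemma span_family:
  fixes b :: "nat \<Rightarrow> 'b"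
  assumes "v \<in> span (b ` {1..m})"
  obtains c where "v = (\<Sum>i=1..m. c i *s b i)"
proof -
  have "span (b ` {1..m}) \<subseteq> {v. \<exists>c. v = (\<Sum>i=1..m. c i *s b i)}"
  proof (rule span_minimal)
    show "b ` {1..m} \<subseteq> {v. \<exists>c. v = (\<Sum>i=1..m. c i *s b i)}"
    proof safe
      fix j assume "j \<in> {1..m}"
      then have "b j = (\<Sum>i=1..m. (if i = j then 1 else 0) *s b i)"
        by (simp add: if_distrib[of "\<lambda>c. c *s _"] cong: if_cong)
      then show "\<exists>c. b j = (\<Sum>i=1..m. c i *s b i)"
        by (rule exI[of _ "\<lambda>i. if i = j then 1 else 0"])
    qed
    show "subspace {v. \<exists>c. v = (\<Sum>i=1..m. c i *s b i)}"
    proof (rule subspaceI)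
      show "0 \<in> {v. \<exists>c. v = (\<Sum>i=1..m. c i *s b i)}"
        by (auto intro!: exI[of _ "\<lambda>_. 0"])
    next
      fix x y assume "x \<in> {v. \<exists>c. v = (\<Sum>i=1..m. c i *s b i)}" "y \<in> {v. \<exists>c. v = (\<Sum>i=1..m. c i *s b i)}"
      then obtain c d where "x = (\<Sum>i=1..m. c i *s b i)" "y = (\<Sum>i=1..m. d i *s b i)" by blast
      then have "x + y = (\<Sum>i=1..m. (c i + d i) *s b i)"
        by (simp add: scale_left_distrib sum.distrib)
      then show "x + y \<in> {v. \<exists>c. v = (\<Sum>i=1..m. c i *s b i)}"
        by (auto intro!: exI[of _ "\<lambda>i. c i + d i"])
    next
      fix a x assume "x \<in> {v. \<exists>c. v = (\<Sum>i=1..m. c i *s b i)}"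
      then obtain c where "x = (\<Sum>i=1..m. c i *s b i)" by blast
      then have "a *s x = (\<Sum>i=1..m. (a * c i) *s b i)"
        by (simp add: scale_sum_right)
      then show "a *s x \<in> {v. \<exists>c. v = (\<Sum>i=1..m. c i *s b i)}"
        by (auto intro!: exI[of _ "\<lambda>i. a * c i"])
    qed
  qed
  then show thesis using that assms by blast
qed

lemma dependent_family:
  fixes b :: "nat \<Rightarrow> 'b"
  assumes "finite B" "b ` {1..m} \<subseteq> span B" "card B < m"
  obtains c i where "(\<Sum>i=1..m. c i *s b i) = 0" "i \<in> {1..m}" "c i \<noteq> 0"
proof (cases "inj_on b {1..m}")
  case True
  then have "card (b ` {1..m}) = m" by (simp add: card_image)
  then have "dependent (b ` {1..m})"
    using independent_span_bound[OF assms(1) _ assms(2)] assms(3) by fastforce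
  then obtain u v where u: "v \<in> b ` {1..m}" "u v \<noteq> 0" "(\<Sum>v\<in>b ` {1..m}. u v *s v) = 0"
    using dependent_finite[of "b ` {1..m}"] by auto
  then obtain i where i: "i \<in> {1..m}" "v = b i" by blast
  have "(\<Sum>i=1..m. u (b i) *s b i) = 0"
    using u(3) True by (simp add: sum.reindex)
  then show thesis using that[of "\<lambda>i. u (b i)" i] i u(2) by simp
next
  case False
  then obtain i j where ij: "i \<in> {1..m}" "j \<in> {1..m}" "i \<noteq> j" "b i = b j"
    by (auto simp: inj_on_def)
  let ?c = "\<lambda>k. (if k = i then 1 else 0) - (if k = j then 1 else 0)"
  have "(\<Sum>k=1..m. ?c k *s b k) = (\<Sum>k=1..m. (if k = i then b k else 0) - (if k = j then b k else 0))"
    by (rule sum.cong) auto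
  also have "\<dots> = 0"
    using ij by (simp add: sum_subtractf)
  finally show thesis using that[of ?c i] ij by simp
qed

end

section \<open>Isomorphisms and multiplication tables\<close>

lemma alg_isomorphic_if_inverse:
  assumes g: "alg_hom B A g" "bij_betw g (carr B) (carr A)"
    and add: "\<And>x y. x \<in> carr B \<Longrightarrow> y \<in> carr B \<Longrightarrow> x + y \<in> carr B"
    and smul: "\<And>c x. x \<in> carr B \<Longrightarrow> smul B c x \<in> carr B"
    and bracket: "\<And>x y. x \<in> carr B \<Longrightarrow> y \<in> carr B \<Longrightarrow> bracket B x y \<in> carr B"
  shows "A \<cong>\<^sub>a B"
proof -
  let ?f = "inv_into (carr B) g"
  have inj: "inj_on g (carr B)" and surj: "g ` carr B = carr A"
    using g(2) by (auto simp: bij_betw_def)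
  have gf: "g (?f x) = x" "?f x \<in> carr B" if "x \<in> carr A" for x
    using that surj by (auto intro: f_inv_into_f inv_into_into)
  have fg: "?f (g x) = x" if "x \<in> carr B" for x
    using that inj by simp
  have "bij_betw ?f (carr A) (carr B)"
    using g(2) by (rule bij_betw_inv_into)
  moreover have "alg_hom A B ?f"
    unfolding alg_hom_def
  proof (intro conjI ballI allI)
    fix x assume x: "x \<in> carr A"
    then show "?f x \<in> carr B" by (rule gf)
    fix c
    have "g (smul B c (?f x)) = smul A c x"
      using g(1) gf[OF x] by (simp add: alg_hom_def)
    then show "?f (smul A c x) = smul B c (?f x)"
      using fg[of "smul B c (?f x)"] smul gf[OF x] by simp
  next
    fix x y assume xy: "x \<in> carr A" "y \<in> carr A"
    have "g (?f x + ?f y) = x + y"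
      using g(1) gf[OF xy(1)] gf[OF xy(2)] by (simp add: alg_hom_def)
    then show "?f (x + y) = ?f x + ?f y"
      using fg[of "?f x + ?f y"] add gf[OF xy(1)] gf[OF xy(2)] by simp
    have "g (bracket B (?f x) (?f y)) = bracket A x y"
      using g(1) gf[OF xy(1)] gf[OF xy(2)] by (simp add: alg_hom_def)
    then show "?f (bracket A x y) = bracket B (?f x) (?f y)"
      using fg[of "bracket B (?f x) (?f y)"] bracket gf[OF xy(1)] gf[OF xy(2)] by simp
  qed
  ultimately show ?thesis unfolding alg_isomorphic_def by blast
qed

interpretation cscale: vector_space cscale
  by unfold_locales (auto simp: cscale_def fun_eq_iff algebra_simps)

lemma cscale_apply: "cscale c v k = c * v k"
  by (simp add: cscale_def)

lemma table_alg_simps [simp]: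
  "smul (table_alg m T) = cscale"
  "v \<in> carr (table_alg m T) \<longleftrightarrow> (\<forall>k. k \<notin> {1..m} \<longrightarrow> v k = 0)"
  "bracket (table_alg m T) x y = (\<Sum>i=1..m. \<Sum>j=1..m. cscale (x i * y j) (T i j))"
  by (simp_all add: table_alg_def)

lemma sum_fun_apply: "(\<Sum>i\<in>I. f i) (k :: 'i) = (\<Sum>i\<in>I. f i k :: complex)"
  by (induction I rule: infinite_finite_induct) auto

lemma table_alg_carr_subspace: "cscale.subspace (carr (table_alg m T))"
  by (rule cscale.subspaceI) (auto simp: cscale_apply)

lemma e_in_table_alg: "i \<in> {1..m} \<Longrightarrow> e i \<in> carr (table_alg m T)"
  by (auto simp: e_def)

lemma table_alg_expand:
  assumes "v \<in> carr (table_alg m T)"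
  shows "v = (\<Sum>i=1..m. cscale (v i) (e i))"
proof
  fix k
  have "(\<Sum>i=1..m. v i * e i k) = (\<Sum>i=1..m. if i = k then v k else 0)"
    by (rule sum.cong) (auto simp: e_def)
  then show "v k = (\<Sum>i=1..m. cscale (v i) (e i)) k"
    using assms by (auto simp: sum_fun_apply cscale_apply)
qed

lemma table_alg_span: "cscale.span (e ` {1..m}) = carr (table_alg m T)"
proof
  show "cscale.span (e ` {1..m}) \<subseteq> carr (table_alg m T)"
    by (intro cscale.span_minimal table_alg_carr_subspace image_subsetI e_in_table_alg)
  show "carr (table_alg m T) \<subseteq> cscale.span (e ` {1..m})"
  proof
    fix v assume "v \<in> carr (table_alg m T)"
    then have "v = (\<Sum>i=1..m. cscale (v i) (e i))" by (rule table_alg_expand)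
    also have "\<dots> \<in> cscale.span (e ` {1..m})"
      by (intro cscale.span_sum cscale.span_scale cscale.span_base) auto
    finally show "v \<in> cscale.span (e ` {1..m})" .
  qed
qed

lemma independent_e: "inj_on e {1..m}" "cscale.independent (e ` {1..m})"
proof -
  show inj: "inj_on e {1..m}"
    by (auto simp: inj_on_def e_def fun_eq_iff)
  show "cscale.independent (e ` {1..m})"
  proof (rule cscale.independent_if_scalars_zero)
    fix f v assume s: "(\<Sum>x\<in>e ` {1..m}. cscale (f x) x) = 0" and v: "v \<in> e ` {1..m}"
    from v obtain k where k: "k \<in> {1..m}" "v = e k" by blast
    have "(\<Sum>i=1..m. cscale (f (e i)) (e i)) k = 0"
      using s inj by (simp add: sum.reindex)
    moreover have "(\<Sum>i=1..m. f (e i) * e i k) = (\<Sum>i=1..m. if i = k then f (e k) else 0)"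
      by (rule sum.cong) (auto simp: e_def)
    ultimately show "f v = 0"
      using k by (simp add: sum_fun_apply cscale_apply)
  qed simp
qed

lemma table_alg_bracket_basis:
  assumes "i \<in> {1..m}" "j \<in> {1..m}"
  shows "bracket (table_alg m T) (e i) (e j) = T i j"
proof -
  have "cscale (e i i' * e j j') (T i' j') = (if j' = j then if i' = i then T i j else 0 else 0)" for i' j'
    by (auto simp: e_def)
  then show ?thesis using assms by simp
qed

context leibniz_algebra
begin

abbreviation scl (infixr "*\<^sub>s" 75) where "c *\<^sub>s x \<equiv> smul A c x"
abbreviation prd (infixl "\<odot>" 75) where "x \<odot> y \<equiv> bracket A x y"

lemma carr_closed [simp]:
  "0 \<in> carr A"
  "x \<in> carr A \<Longrightarrow> y \<in> carr A \<Longrightarrow> x + y \<in> carr A"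
  "x \<in> carr A \<Longrightarrow> y \<in> carr A \<Longrightarrow> x - y \<in> carr A"
  "x \<in> carr A \<Longrightarrow> - x \<in> carr A"
  "x \<in> carr A \<Longrightarrow> c *\<^sub>s x \<in> carr A"
  "x \<in> carr A \<Longrightarrow> y \<in> carr A \<Longrightarrow> x \<odot> y \<in> carr A"
  using carr_subspace bracket_closed
  by (simp_all add: subspace_0 subspace_add subspace_diff subspace_neg subspace_scale)

lemma carr_sum [simp]: "(\<And>i. i \<in> I \<Longrightarrow> f i \<in> carr A) \<Longrightarrow> (\<Sum>i\<in>I. f i) \<in> carr A"
  using carr_subspace by (rule subspace_sum)

lemma bracket_zero [simp]:
  "x \<in> carr A \<Longrightarrow> 0 \<odot> x = 0" "x \<in> carr A \<Longrightarrow> x \<odot> 0 = 0"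
  using bracket_smul_left[of 0 x 0] bracket_smul_right[of x 0 0] by simp_all

lemma bracket_diff_left:
  assumes "x \<in> carr A" "y \<in> carr A" "z \<in> carr A" shows "(x - y) \<odot> z = x \<odot> z - y \<odot> z"
  using bracket_add_left[of "x - y" y z] assms by (simp add: algebra_simps)

lemma bracket_diff_right:
  assumes "x \<in> carr A" "y \<in> carr A" "z \<in> carr A" shows "x \<odot> (y - z) = x \<odot> y - x \<odot> z"
  using bracket_add_right[of x "y - z" z] assms by (simp add: algebra_simps)

lemmas bracket_bilinear =
  bracket_add_left bracket_add_right bracket_diff_left bracket_diff_right
  bracket_smul_left bracket_smul_right

lemma bracket_sum_left:
  assumes "\<And>i. i \<in> I \<Longrightarrow> f i \<in> carr A" "z \<in> carr A"
  shows "(\<Sum>i\<in>I. f i) \<odot> z = (\<Sum>i\<in>I. f i \<odot> z)"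
  using assms by (induction I rule: infinite_finite_induct) (simp_all add: bracket_add_left)

lemma bracket_sum_right:
  assumes "\<And>i. i \<in> I \<Longrightarrow> f i \<in> carr A" "z \<in> carr A"
  shows "z \<odot> (\<Sum>i\<in>I. f i) = (\<Sum>i\<in>I. z \<odot> f i)"
  using assms by (induction I rule: infinite_finite_induct) (simp_all add: bracket_add_right)

text \<open>
  An algebra is recognised by the multiplication table of a basis: the map that sends coordinates to
  linear combinations of the basis is an isomorphism from the table algebra.
\<close>

lemma alg_isomorphic_table_alg:
  assumes inj: "inj_on b {1..m}" and ind: "independent (b ` {1..m})"
    and span: "span (b ` {1..m}) = carr A"
    and T: "\<And>i j k. i \<in> {1..m} \<Longrightarrow> j \<in> {1..m} \<Longrightarrow> k \<notin> {1..m} \<Longrightarrow> T i j k = 0"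
    and tab: "\<And>i j. i \<in> {1..m} \<Longrightarrow> j \<in> {1..m} \<Longrightarrow>
      b i \<odot> b j = (\<Sum>k=1..m. T i j k *\<^sub>s b k)"
  shows "A \<cong>\<^sub>a table_alg m T"
proof (rule alg_isomorphic_if_inverse)
  let ?B = "table_alg m T"
  let ?g = "\<lambda>v. \<Sum>k=1..m. v k *\<^sub>s b k"
  have b: "b i \<in> carr A" if "i \<in> {1..m}" for i
    using that span span_superset by blast
  have g_in: "?g v \<in> carr A" for v
    using b by (intro carr_sum carr_closed)
  have g_sum: "?g (\<Sum>i\<in>I. f i) = (\<Sum>i\<in>I. ?g (f i))" for f :: "nat \<Rightarrow> nat \<Rightarrow> complex" and I
    by (simp add: sum_fun_apply scale_sum_left sum.swap[of _ I])
  have g_scale: "?g (cscale c v) = c *\<^sub>s ?g v" for c v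
    by (simp add: cscale_apply scale_sum_right)
  show "alg_hom ?B A ?g"
    unfolding alg_hom_def
  proof (intro conjI ballI allI)
    fix x y assume xy: "x \<in> carr ?B" "y \<in> carr ?B"
    show "?g x \<in> carr A" by (rule g_in)
    show "?g (x + y) = ?g x + ?g y"
      by (simp add: scale_left_distrib sum.distrib)
    show "?g (smul ?B c x) = c *\<^sub>s ?g x" for c
      using g_scale by simp
    have "?g (bracket ?B x y) = (\<Sum>i=1..m. \<Sum>j=1..m. (x i * y j) *\<^sub>s ?g (T i j))"
      unfolding table_alg_simps g_sum g_scale ..
    also have "\<dots> = (\<Sum>i=1..m. \<Sum>j=1..m. (x i * y j) *\<^sub>s (b i \<odot> b j))"
      using tab by (intro sum.cong) auto
    also have "\<dots> = (\<Sum>i=1..m. \<Sum>j=1..m. (x i *\<^sub>s b i) \<odot> (y j *\<^sub>s b j))"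
      using b by (intro sum.cong) (auto simp: bracket_bilinear)
    also have "\<dots> = (\<Sum>i=1..m. (x i *\<^sub>s b i) \<odot> ?g y)"
      using b by (intro sum.cong refl bracket_sum_right[symmetric] carr_closed)
    also have "\<dots> = ?g x \<odot> ?g y"
      using b g_in by (intro bracket_sum_left[symmetric] carr_closed)
    finally show "?g (bracket ?B x y) = ?g x \<odot> ?g y" .
  qed
  show "bij_betw ?g (carr ?B) (carr A)"
    unfolding bij_betw_def
  proof
    show "inj_on ?g (carr ?B)"
    proof (rule inj_onI)
      fix v w assume vw: "v \<in> carr ?B" "w \<in> carr ?B" "?g v = ?g w"
      then have "(\<Sum>i=1..m. (v i - w i) *\<^sub>s b i) = 0"
        by (simp add: scale_left_diff_distrib sum_subtractf)
      then have "v i - w i = 0" if "i \<in> {1..m}" for i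
        using independent_family_eq_0[OF inj ind, of "\<lambda>i. v i - w i"] that by blast
      then show "v = w" using vw by (intro ext) (metis eq_iff_diff_eq_0 table_alg_simps(2))
    qed
    show "?g ` carr ?B = carr A"
    proof
      show "?g ` carr ?B \<subseteq> carr A" using g_in by blast
      show "carr A \<subseteq> ?g ` carr ?B"
      proof
        fix u assume "u \<in> carr A"
        then obtain c where c: "u = (\<Sum>i=1..m. c i *\<^sub>s b i)"
          using span span_family by blast
        let ?c = "\<lambda>i. if i \<in> {1..m} then c i else 0"
        have "u = ?g ?c" unfolding c by (rule sum.cong) auto
        moreover have "?c \<in> carr ?B" by simp
        ultimately show "u \<in> ?g ` carr ?B" by (rule image_eqI)
      qed
    qed
  qed
  show "x + y \<in> carr ?B" "smul ?B c x \<in> carr ?B" if "x \<in> carr ?B" "y \<in> carr ?B" for x y c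
    using that by (simp_all add: cscale_apply)
  show "bracket ?B x y \<in> carr ?B" if "x \<in> carr ?B" "y \<in> carr ?B" for x y
    using T by (simp add: sum_fun_apply cscale_apply)
qed

lemma leibniz_algebra_isomorphic_image:
  fixes B :: "'b::ab_group_add calg"
  assumes f: "alg_hom A B f" "bij_betw f (carr A) (carr B)"
    and B: "vector_space (smul B)" "module.subspace (smul B) (carr B)"
       "\<exists>S. finite S \<and> module.span (smul B) S = carr B"
  shows "leibniz_algebra B"
proof -
  interpret B: vector_space "smul B" by fact
  have fadd: "f x + f y = f (x + y)" and fscale: "smul B c (f x) = f (c *\<^sub>s x)"
    and fbr: "bracket B (f x) (f y) = f (x \<odot> y)" if "x \<in> carr A" "y \<in> carr A" for x y c
    using f that by (auto simp: alg_hom_def)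
  have fdiff: "f x - f y = f (x - y)" if "x \<in> carr A" "y \<in> carr A" for x y
    using fadd[of "x - y" y] that by (simp add: algebra_simps)
  have img: "f ` carr A = carr B" using f(2) by (simp add: bij_betw_def)
  note fs = fadd fscale fbr fdiff
  show ?thesis
  proof
    show "B.subspace (carr B)" "\<exists>S. finite S \<and> B.span S = carr B" by fact+
  next
    fix x y assume "x \<in> carr B" "y \<in> carr B"
    then obtain x' y' where "x = f x'" "y = f y'" and c: "x' \<in> carr A" "y' \<in> carr A"
      using img by blast
    then show "bracket B x y \<in> carr B"
      and "bracket B (smul B c x) y = smul B c (bracket B x y)"
      and "bracket B x (smul B c y) = smul B c (bracket B x y)" for c
      using img by (auto simp: fs bracket_bilinear)
    fix z assume "z \<in> carr B"
    then obtain z' where z: "z = f z'" "z' \<in> carr A" using img by blast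
    show "bracket B (x + y) z = bracket B x z + bracket B y z"
      and "bracket B x (y + z) = bracket B x y + bracket B x z"
      and "bracket B x (bracket B y z) = bracket B (bracket B x y) z - bracket B (bracket B x z) y"
      using c z \<open>x = f x'\<close> \<open>y = f y'\<close> by (simp_all add: fs bracket_bilinear leibniz)
  qed
qed

text \<open>
  The definition of a split extension asks for a summand inside \<open>nat \<Rightarrow> complex\<close>. A subalgebra
  of an arbitrary ambient space is moved there through its structure constants.
\<close>

lemma isomorphic_to_table_alg:
  obtains m T where "A \<cong>\<^sub>a table_alg m T" "leibniz_algebra (table_alg m T)"
proof -
  obtain S where S: "finite S" "span S = carr A" using finite_dimensional by blast
  obtain B where B: "B \<subseteq> S" "independent B" "S \<subseteq> span B"
    using maximal_independent_subset by blast
  have spanB: "span B = carr A"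
    using B S by (metis span_eq span_superset subset_trans span_mono)
  have "finite B" using B(1) S(1) finite_subset by blast
  then obtain b0 :: "nat \<Rightarrow> 'a" where "bij_betw b0 {1..card B} B"
    using ex_bij_betw_nat_finite_1 by blast
  then have inj: "inj_on b0 {1..card B}" and im: "b0 ` {1..card B} = B"
    by (auto simp: bij_betw_def)
  let ?m = "card B"
  have b: "b0 i \<in> carr A" if "i \<in> {1..?m}" for i
    using that im spanB span_superset by blast
  have "\<exists>c. b0 i \<odot> b0 j = (\<Sum>k=1..?m. c k *\<^sub>s b0 k) \<and> (\<forall>k. k \<notin> {1..?m} \<longrightarrow> c k = 0)"
    if ij: "i \<in> {1..?m}" "j \<in> {1..?m}" for i j
  proof -
    have "b0 i \<odot> b0 j \<in> span (b0 ` {1..?m})" using b ij spanB im by simp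
    then obtain c where c: "b0 i \<odot> b0 j = (\<Sum>k=1..?m. c k *\<^sub>s b0 k)" by (rule span_family)
    show ?thesis
      by (rule exI[of _ "\<lambda>k. if k \<in> {1..?m} then c k else 0"]) (auto simp: c intro!: sum.cong)
  qed
  then obtain T where T: "\<And>i j. i \<in> {1..?m} \<Longrightarrow> j \<in> {1..?m} \<Longrightarrow>
      b0 i \<odot> b0 j = (\<Sum>k=1..?m. T i j k *\<^sub>s b0 k) \<and> (\<forall>k. k \<notin> {1..?m} \<longrightarrow> T i j k = 0)"
    by metis
  have iso: "A \<cong>\<^sub>a table_alg ?m T"
    by (rule alg_isomorphic_table_alg[OF inj]) (use B im spanB T in auto)
  then obtain f where "alg_hom A (table_alg ?m T) f" "bij_betw f (carr A) (carr (table_alg ?m T))"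
    by (auto simp: alg_isomorphic_def)
  then have "leibniz_algebra (table_alg ?m T)"
    by (rule leibniz_algebra_isomorphic_image)
      (use cscale.vector_space_axioms table_alg_carr_subspace table_alg_span
        in \<open>auto intro!: exI[of _ "e ` {1..?m}"]\<close>)
  then show thesis using iso that by blast
qed

end

section \<open>The kernel of a non-split central extension\<close>

context leibniz_algebra
begin

definition derived :: "'a set" where
  "derived = span {x \<odot> y | x y. x \<in> carr A \<and> y \<in> carr A}"

lemma subspace_derived: "subspace derived"
  by (simp add: derived_def subspace_span)

lemma bracket_in_derived: "x \<in> carr A \<Longrightarrow> y \<in> carr A \<Longrightarrow> x \<odot> y \<in> derived"
  unfolding derived_def by (rule span_base) blast

lemma derived_subset: "derived \<subseteq> carr A"
  unfolding derived_def using carr_subspace by (intro span_minimal) auto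

lemma finite_basis_of_subspace:
  assumes "subspace S" "S \<subseteq> carr A"
  obtains B where "finite B" "B \<subseteq> S" "independent B" "span B = S" "card B = dim S"
proof -
  obtain F where F: "finite F" "span F = carr A" using finite_dimensional by blast
  obtain B where B: "B \<subseteq> S" "independent B" "S \<subseteq> span B" "card B = dim S"
    using basis_exists by blast
  moreover have "finite B"
    using independent_span_bound[OF F(1) B(2)] B(1) assms(2) F(2) by blast
  moreover have "span B = S"
    using B assms(1) by (simp add: span_minimal subset_antisym)
  ultimately show thesis using that by blast
qed

lemma leibniz_subalgebra:
  assumes S: "subspace S" "S \<subseteq> carr A"
    and closed: "\<And>x y. x \<in> S \<Longrightarrow> y \<in> S \<Longrightarrow> x \<odot> y \<in> S"
  shows "leibniz_algebra \<lparr>smul = smul A, carr = S, bracket = bracket A\<rparr>"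
proof -
  have c: "x \<in> carr A" if "x \<in> S" for x using that S by blast
  obtain B where "finite B" "span B = S" using finite_basis_of_subspace[OF S] by blast
  then have basis: "\<exists>B. finite B \<and> span B = S" by blast
  show ?thesis
    using vector_space_axioms
    unfolding leibniz_algebra_def leibniz_algebra_axioms_def calg.simps
    by (intro conjI allI impI S(1) basis closed bracket_add_left bracket_add_right
        bracket_smul_left bracket_smul_right leibniz c)
qed

text \<open>
  A basis of the derived algebra together with \<open>z\<close> extends to a basis of the algebra; discarding
  \<open>z\<close> leaves a basis of a hyperplane \<open>M\<close>. As \<open>M\<close> contains the derived algebra, it is an ideal.
\<close>

lemma complement_of_line:
  assumes z: "z \<in> carr A" "z \<notin> derived"
  obtains M where "subspace M" "derived \<subseteq> M" "M \<subseteq> carr A" "z \<notin> M"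
    "\<And>u. u \<in> carr A \<Longrightarrow> \<exists>c. u - c *\<^sub>s z \<in> M"
proof -
  obtain D where D: "D \<subseteq> derived" "independent D" "span D = derived"
    by (rule finite_basis_of_subspace[OF subspace_derived derived_subset])
  have "independent (insert z D)"
    using D z by (intro independent_insertI) auto
  moreover have "insert z D \<subseteq> carr A" using D(1) derived_subset z by blast
  ultimately obtain B where B: "insert z D \<subseteq> B" "B \<subseteq> carr A" "independent B" "carr A \<subseteq> span B"
    using maximal_independent_subset_extend[of "insert z D" "carr A"] by blast
  have ins: "insert z (B - {z}) = B" using B(1) by blast
  have zD: "z \<notin> D" using D z by blast
  show thesis
  proof
    show "subspace (span (B - {z}))" by simp
    show "derived \<subseteq> span (B - {z})"
      unfolding D(3)[symmetric] using B(1) zD by (intro span_mono) blast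
    show "span (B - {z}) \<subseteq> carr A"
      using B(2) carr_subspace by (intro span_minimal) auto
    show "z \<notin> span (B - {z})"
    proof -
      have "z \<in> B" using B(1) by simp
      then show ?thesis using B(3) unfolding dependent_def by meson
    qed
    show "\<exists>c. u - c *\<^sub>s z \<in> span (B - {z})" if "u \<in> carr A" for u
      using that B(4) span_breakdown_eq[of u z "B - {z}"] unfolding ins by (meson subsetD)
  qed
qed

lemma dim_of_complement_of_line:
  assumes K: "subspace K" "K \<subseteq> carr A" and M: "subspace M" "z \<notin> M" "z \<in> K"
    and compl: "\<And>u. u \<in> carr A \<Longrightarrow> \<exists>c. u - c *\<^sub>s z \<in> M"
  shows "dim K = dim (K \<inter> M) + 1"
proof -
  have "subspace (K \<inter> M)" using K(1) M(1) by (rule subspace_inter)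
  then obtain B where B: "finite B" "B \<subseteq> K \<inter> M" "independent B" "span B = K \<inter> M"
      "card B = dim (K \<inter> M)"
    by (rule finite_basis_of_subspace) (use K(2) in auto)
  have "independent (insert z B)"
    using B M by (intro independent_insertI) auto
  moreover have "K \<subseteq> span (insert z B)"
  proof
    fix u assume u: "u \<in> K"
    then obtain c where "u - c *\<^sub>s z \<in> M" using compl K(2) by blast
    moreover have "u - c *\<^sub>s z \<in> K" using u K(1) M(3) by (simp add: subspace_diff subspace_scale)
    ultimately show "u \<in> span (insert z B)"
      unfolding span_breakdown_eq B(4) by blast
  qed
  moreover have "insert z B \<subseteq> K" using B(2) M(3) by blast
  ultimately have "dim K = card (insert z B)"
    by (intro basis_card_eq_dim[symmetric])
  moreover have "z \<notin> B" using B(2) M(2) by blast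
  ultimately show ?thesis using B(1,5) by simp
qed

end

text \<open>
  A central element \<open>z\<close> of the kernel outside the derived algebra would split off: with \<open>M\<close> as in
  \<open>complement_of_line\<close>, the algebra is the direct sum of \<open>M\<close> and the line through \<open>z\<close>, and \<open>M\<close>
  is still an extension of \<open>L\<close>, with a kernel of dimension one less.
\<close>

lemma non_split_extension_kernel:
  fixes E :: "'e::ab_group_add calg" and L :: "'l::ab_group_add calg"
  assumes ns: "non_split_extension k E L" and k: "1 \<le> k"
  obtains \<pi> where "leibniz_algebra E" "leibniz_algebra L" "alg_hom E L \<pi>" "\<pi> ` carr E = carr L"
    "{x \<in> carr E. \<pi> x = 0} \<subseteq> alg_center E"
    "vector_space.dim (smul E) {x \<in> carr E. \<pi> x = 0} = k"
    "{x \<in> carr E. \<pi> x = 0} \<subseteq> leibniz_algebra.derived E"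
proof -
  have ext: "central_extension k E L" and not_split: "\<not> split_extension k E L"
    using ns by (auto simp: non_split_extension_def)
  from ext obtain V :: "(nat \<Rightarrow> complex) calg" and \<iota> \<pi> where
    lE: "leibniz_algebra E" and lL: "leibniz_algebra L" and lV: "leibniz_algebra V"
    and dimV: "vector_space.dim (smul V) (carr V) = k"
    and exact: "short_exact V \<iota> E \<pi> L" and central: "\<iota> ` carr V \<subseteq> alg_center E"
    unfolding central_extension_def by blast
  interpret E: leibniz_algebra E by fact
  interpret L: leibniz_algebra L by fact
  interpret V: leibniz_algebra V by fact
  define K where "K = {x \<in> carr E. \<pi> x = 0}"
  have \<pi>: "alg_hom E L \<pi>" "\<pi> ` carr E = carr L" and \<iota>: "alg_hom V E \<iota>" "inj_on \<iota> (carr V)"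
    and K: "\<iota> ` carr V = K"
    using exact by (auto simp: short_exact_def K_def)
  have Kc: "K \<subseteq> alg_center E" using central K by simp
  have \<pi>_scale: "\<pi> (smul E c x) = smul L c (\<pi> x)" if "x \<in> carr E" for x c
    using \<pi>(1) that by (auto simp: alg_hom_def)
  have \<pi>_add: "\<pi> (x + y) = \<pi> x + \<pi> y"
    and \<pi>_bracket: "\<pi> (bracket E x y) = bracket L (\<pi> x) (\<pi> y)"
    if "x \<in> carr E" "y \<in> carr E" for x y
    using \<pi>(1) that by (auto simp: alg_hom_def)
  have \<pi>0: "\<pi> 0 = 0" using \<pi>_scale[of 0 0] by simp
  have dimK: "E.dim K = k"
    unfolding K[symmetric] dimV[symmetric]
    by (rule hom_on_subspace_dim)
      (use \<iota> V.vector_space_axioms E.vector_space_axioms V.carr_subspace in \<open>auto simp: alg_hom_def\<close>)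
  have subK: "E.subspace K" "K \<subseteq> carr E"
    unfolding K_def by (auto intro!: E.subspaceI simp: \<pi>_add \<pi>_scale \<pi>0)
  have "K \<subseteq> E.derived"
  proof (rule ccontr)
    assume "\<not> K \<subseteq> E.derived"
    then obtain z where z: "z \<in> K" "z \<notin> E.derived" by blast
    have zE: "z \<in> carr E" and \<pi>z: "\<pi> z = 0" using z by (auto simp: K_def)
    have z_central: "bracket E x z = 0" "bracket E z x = 0" if "x \<in> carr E" for x
      using z(1) Kc that by (auto simp: alg_center_def)
    obtain M where M: "E.subspace M" "E.derived \<subseteq> M" "M \<subseteq> carr E" "z \<notin> M"
      and compl: "\<And>u. u \<in> carr E \<Longrightarrow> \<exists>c. u - smul E c z \<in> M"
      using E.complement_of_line[OF zE z(2)] by blast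
    let ?M = "\<lparr>smul = smul E, carr = M, bracket = bracket E\<rparr>"
    have "leibniz_algebra ?M"
      using M(1,3)
    proof (rule E.leibniz_subalgebra)
      fix x y assume "x \<in> M" "y \<in> M"
      then show "bracket E x y \<in> M" using M(2,3) E.bracket_in_derived by blast
    qed
    then interpret M: leibniz_algebra "?M" .
    obtain m T where M_table: "?M \<cong>\<^sub>a table_alg m T" and lL': "leibniz_algebra (table_alg m T)"
      by (rule M.isomorphic_to_table_alg)
    define L' where "L' = table_alg m T"
    interpret L': leibniz_algebra L' using lL' by (simp add: L'_def)
    have smulL': "smul L' = cscale" by (simp add: L'_def)
    have "L' \<cong>\<^sub>a ?M"
    proof -
      from M_table obtain f where "alg_hom ?M L' f" "bij_betw f (carr ?M) (carr L')"
        unfolding alg_isomorphic_def L'_def by blast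
      then show ?thesis
        by (rule alg_isomorphic_if_inverse) (rule M.carr_closed; assumption)+
    qed
    then obtain g where g: "alg_hom L' ?M g" and bij: "bij_betw g (carr L') M"
      by (auto simp: alg_isomorphic_def)
    have inj: "inj_on g (carr L')" and img: "g ` carr L' = M"
      using bij by (auto simp: bij_betw_def)
    have g_in: "g x \<in> M" "g x \<in> carr E" and g_scale: "g (smul L' c x) = smul E c (g x)"
      if "x \<in> carr L'" for x c
      using g that M(3) by (auto simp: alg_hom_def)
    have g_add: "g (x + y) = g x + g y"
      and g_bracket: "g (bracket L' x y) = bracket E (g x) (g y)"
      if "x \<in> carr L'" "y \<in> carr L'" for x y
      using g that by (auto simp: alg_hom_def)
    have g0: "g 0 = 0" using g_scale[of 0 0] by simp
    let ?p = "\<lambda>x. \<pi> (g x)"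
    define K' where "K' = {x \<in> carr L'. ?p x = 0}"
    have p: "alg_hom L' L ?p"
      unfolding alg_hom_def
      using g_in \<pi>(2) by (auto simp: g_add g_scale g_bracket \<pi>_add \<pi>_scale \<pi>_bracket)
    have p_surj: "?p ` carr L' = carr L"
    proof -
      have "carr L \<subseteq> \<pi> ` M"
      proof
        fix l assume "l \<in> carr L"
        then obtain u where u: "u \<in> carr E" "l = \<pi> u" using \<pi>(2) by blast
        then obtain c where c: "u - smul E c z \<in> M" using compl by blast
        have "\<pi> u = \<pi> (u - smul E c z) + \<pi> (smul E c z)"
          using \<pi>_add[of "u - smul E c z" "smul E c z"] u zE by simp
        then have "l = \<pi> (u - smul E c z)" using u \<pi>_scale[OF zE] \<pi>z by simp
        then show "l \<in> \<pi> ` M" using c by blast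
      qed
      then show ?thesis using img M(3) \<pi>(2) by auto
    qed
    have subK': "L'.subspace K'" "K' \<subseteq> carr L'"
      unfolding K'_def
      by (auto intro!: L'.subspaceI simp: g_add g_scale g_in \<pi>_add \<pi>_scale \<pi>0 g0)
    have gK': "g ` K' = K \<inter> M"
      using img M(3) by (auto simp: K'_def K_def)
    have K'_central: "K' \<subseteq> alg_center L'"
    proof
      fix x assume x: "x \<in> K'"
      then have xL: "x \<in> carr L'" and gx: "g x \<in> alg_center E"
        using gK' Kc subK' by auto
      have "bracket L' y x = 0 \<and> bracket L' x y = 0" if y: "y \<in> carr L'" for y
      proof -
        have "g (bracket L' y x) = g 0" "g (bracket L' x y) = g 0"
          using gx g_in[OF y] by (auto simp: g_bracket xL y g0 alg_center_def)
        then show ?thesis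
          using inj_onD[OF inj] xL y by (meson L'.carr_closed(1,6))
      qed
      then show "x \<in> alg_center L'" using xL by (simp add: alg_center_def)
    qed
    let ?V = "\<lparr>smul = smul L', carr = K', bracket = bracket L'\<rparr>"
    have lV': "leibniz_algebra ?V"
      using subK'
    proof (rule L'.leibniz_subalgebra)
      fix x y assume "x \<in> K'" "y \<in> K'"
      then have "bracket L' x y = 0" using K'_central subK' by (auto simp: alg_center_def)
      then show "bracket L' x y \<in> K'" using L'.subspace_0[OF subK'(1)] by simp
    qed
    have "E.dim (g ` K') = L'.dim K'"
      by (rule hom_on_subspace_dim)
        (use L'.vector_space_axioms E.vector_space_axioms subK' inj
          in \<open>auto intro: inj_on_subset g_add g_scale\<close>)
    then have dimK': "vector_space.dim (smul ?V) (carr ?V) = k - 1"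
      using E.dim_of_complement_of_line[OF subK M(1,4) z(1) compl] dimK gK' by simp
    have exact': "short_exact ?V (\<lambda>x. x) L' ?p L"
      unfolding short_exact_def using p p_surj subK' by (auto simp: alg_hom_def K'_def)
    have central': "(\<lambda>x. x) ` carr ?V \<subseteq> alg_center L'"
      using K'_central by simp
    have ext': "central_extension (k - 1) L' L"
      unfolding central_extension_def
      using L'.leibniz_algebra_axioms lL lV' dimK' exact' central' by blast
    let ?S = "direct_sum L' abelian_line"
    have S: "carr ?S = carr L' \<times> UNIV" "smul ?S c x = (smul L' c (fst x), c * snd x)"
      "bracket ?S x y = (bracket L' (fst x) (fst y), 0)" for c x y
      by (simp_all add: direct_sum_def abelian_line_def)
    let ?h = "\<lambda>x. g (fst x) + smul E (snd x) z"
    have "E \<cong>\<^sub>a ?S"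
    proof (rule alg_isomorphic_if_inverse)
      show "alg_hom ?S E ?h"
        unfolding alg_hom_def
      proof (intro conjI ballI allI)
        fix x y c assume "x \<in> carr ?S" "y \<in> carr ?S"
        then have xy: "fst x \<in> carr L'" "fst y \<in> carr L'" by (auto simp: S)
        note g_xy = g_in(2)[OF xy(1)] g_in(2)[OF xy(2)]
        show "?h x \<in> carr E" using g_xy zE by simp
        show "?h (x + y) = ?h x + ?h y"
          by (simp add: g_add[OF xy] E.scale_left_distrib)
        show "?h (smul ?S c x) = smul E c (?h x)"
          by (simp add: S g_scale[OF xy(1)] E.scale_right_distrib)
        show "?h (bracket ?S x y) = bracket E (?h x) (?h y)"
          by (simp add: S g_bracket[OF xy] g_xy zE E.bracket_bilinear z_central)
      qed
      show "bij_betw ?h (carr ?S) (carr E)"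
        unfolding bij_betw_def
      proof
        show "inj_on ?h (carr ?S)"
        proof (rule inj_onI)
          fix x y assume x: "x \<in> carr ?S" and y: "y \<in> carr ?S" and eq: "?h x = ?h y"
          have xL: "fst x \<in> carr L'" "fst y \<in> carr L'" using x y by (auto simp: S)
          have M1: "g (fst y) - g (fst x) \<in> M"
            using g_in(1)[OF xL(1)] g_in(1)[OF xL(2)] by (intro E.subspace_diff[OF M(1)])
          have eq': "smul E (snd x - snd y) z = g (fst y) - g (fst x)"
            using eq by (simp add: E.scale_left_diff_distrib algebra_simps)
          have snd: "snd x = snd y"
          proof (rule ccontr)
            assume "snd x \<noteq> snd y"
            then have "z = smul E (inverse (snd x - snd y)) (smul E (snd x - snd y) z)" by simp
            also have "\<dots> \<in> M" unfolding eq' using M1 by (rule E.subspace_scale[OF M(1)])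
            finally have "z \<in> M" .
            then show False using M(4) by simp
          qed
          then have "fst x = fst y" using eq inj_onD[OF inj] xL by simp
          then show "x = y" using snd by (rule prod_eqI)
        qed
        show "?h ` carr ?S = carr E"
        proof
          show "?h ` carr ?S \<subseteq> carr E"
          proof (rule image_subsetI)
            fix x assume "x \<in> carr ?S"
            then have "g (fst x) \<in> carr E" using g_in(2) by (auto simp: S)
            then show "?h x \<in> carr E" using zE by simp
          qed
          show "carr E \<subseteq> ?h ` carr ?S"
          proof
            fix u assume "u \<in> carr E"
            then obtain c where "u - smul E c z \<in> M" using compl by blast
            then obtain l where l: "l \<in> carr L'" "g l = u - smul E c z"
              unfolding img[symmetric] by (metis imageE)
            then have "u = ?h (l, c)" "(l, c) \<in> carr ?S" by (simp_all add: S)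
            then show "u \<in> ?h ` carr ?S" by (rule image_eqI)
          qed
        qed
      qed
    qed (auto simp: S)
    then have "split_extension k E L"
      unfolding split_extension_def using ext k ext' by blast
    then show False using not_split by simp
  qed
  with Kc dimK show thesis
    unfolding K_def by (intro that[OF lE lL \<pi>])
qed

section \<open>Adapted pairs of generators\<close>

text \<open>
  These are the properties of a non-split extension of \<open>F1 n\<close> with kernel \<open>K\<close> from which the
  normal forms are derived. The quotient map is absent on purpose: a change of generators need not
  be compatible with a fixed map to \<open>F1 n\<close>.
\<close>

locale filiform_extension = leibniz_algebra A for A :: "'a::ab_group_add calg" +
  fixes K :: "'a set" and n :: nat
  assumes n: "3 \<le> n"
    and K_subspace: "subspace K"
    and K_central: "K \<subseteq> alg_center A"
    and K_derived: "K \<subseteq> derived"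
    and dim_K: "dim K = 3"
    and dim_A: "n + 3 \<le> dim (carr A)"
begin

primrec rpow :: "'a \<Rightarrow> nat \<Rightarrow> 'a \<Rightarrow> 'a" where
  "rpow x 0 y = y"
| "rpow x (Suc k) y = rpow x k y \<odot> x"

definition w1 where "w1 x y = x \<odot> x - y \<odot> x"
definition w2 where "w2 x y = rpow x (n - 1) y"
definition w3 where "w3 x y = x \<odot> y"
definition w4 where "w4 x y = y \<odot> y"

text \<open>
  A pair is adapted if modulo \<open>K\<close> it satisfies the defining relations of the generators \<open>e 1\<close>, \<open>e 2\<close>
  of \<open>F1 n\<close>, whose basis is \<open>x\<close> and the products \<open>rpow x k y\<close>.
\<close>

definition adapted :: "'a \<Rightarrow> 'a \<Rightarrow> bool" where
  "adapted x y \<longleftrightarrow> x \<in> carr A \<and> y \<in> carr A \<and>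
    w1 x y \<in> K \<and> w2 x y \<in> K \<and> w3 x y \<in> K \<and> w4 x y \<in> K \<and>
    carr A \<subseteq> span (insert x ((\<lambda>k. rpow x k y) ` {..<n - 1}) \<union> K)"

lemma K_carr: "v \<in> K \<Longrightarrow> v \<in> carr A"
  and K_bracket: "v \<in> K \<Longrightarrow> u \<in> carr A \<Longrightarrow> u \<odot> v = 0" "v \<in> K \<Longrightarrow> u \<in> carr A \<Longrightarrow> v \<odot> u = 0"
  using K_central by (auto simp: alg_center_def)

lemma rpow_closed [simp]: "x \<in> carr A \<Longrightarrow> y \<in> carr A \<Longrightarrow> rpow x k y \<in> carr A"
  by (induction k) simp_all

context
  fixes x y :: 'a
  assumes xy: "adapted x y"
begin

lemma adapted_simps [simp]: "x \<in> carr A" "y \<in> carr A"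
  "w1 x y \<in> K" "w2 x y \<in> K" "w3 x y \<in> K" "w4 x y \<in> K"
  using xy by (simp_all add: adapted_def)

lemmas w_carr [simp] = adapted_simps(3-6)[THEN K_carr]
lemmas w_bracket [simp] = adapted_simps(3-6)[THEN K_bracket(1)] adapted_simps(3-6)[THEN K_bracket(2)]

lemma xx: "x \<odot> x = y \<odot> x + w1 x y"
  by (simp add: w1_def)

lemma xy_yy: "x \<odot> y = w3 x y" "y \<odot> y = w4 x y"
  by (simp_all add: w3_def w4_def)

lemma adapted_induct:
  assumes "u \<in> carr A" "subspace S" "x \<in> S" "\<And>k. k < n - 1 \<Longrightarrow> rpow x k y \<in> S" "K \<subseteq> S"
  shows "u \<in> S"
proof -
  have "span (insert x ((\<lambda>k. rpow x k y) ` {..<n - 1}) \<union> K) \<subseteq> S"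
    using assms by (intro span_minimal) auto
  then show ?thesis using xy assms(1) by (auto simp: adapted_def)
qed

text \<open>
  The reason is that \<open>[x,y]\<close> and \<open>[y,y]\<close> are central: expand \<open>[u,[x,y]] = 0\<close> for \<open>u = [y x\<^sup>k]\<close> by
  the Leibniz identity.
\<close>

lemma chain_bracket_y: "rpow x (Suc k) y \<odot> y = 0"
proof (induction k)
  case 0
  show ?case using leibniz[of y x y] by (simp add: xy_yy)
next
  case (Suc k)
  show ?case using leibniz[of "rpow x (Suc k) y" x y] Suc.IH by (simp add: xy_yy)
qed

lemma subspace_annihilated: "u \<in> carr A \<Longrightarrow> subspace {z \<in> carr A. z \<odot> u = 0}"
  by (rule subspaceI) (simp_all add: bracket_bilinear)

text \<open>
  Right multiplication by \<open>[y,x]\<close> is \<open>R\<^sub>x R\<^sub>y - R\<^sub>y R\<^sub>x\<close>, which vanishes on each generator because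
  \<open>[x,y]\<close>, \<open>[y,y]\<close> are central and \<open>chain_bracket_y\<close> disposes of the rest. For longer products
  the same commutator formula gives an induction.
\<close>

lemma bracket_chain: "u \<in> carr A \<Longrightarrow> u \<odot> rpow x (Suc k) y = 0"
proof (induction k arbitrary: u)
  case 0
  have "x \<odot> (y \<odot> x) = - ((y \<odot> x + w1 x y) \<odot> y)"
    using leibniz[of x y x] by (simp add: xy_yy xx)
  then have "x \<odot> (y \<odot> x) = 0"
    using chain_bracket_y[of 0] by (simp add: bracket_add_left)
  moreover have "rpow x k y \<odot> (y \<odot> x) = 0" for k
    using leibniz[of "rpow x k y" y x] chain_bracket_y[of k] chain_bracket_y[of "k - 1"]
    by (cases k) (simp_all add: xy_yy)
  ultimately have "u \<in> {z \<in> carr A. z \<odot> (y \<odot> x) = 0}"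
    by (intro adapted_induct[OF \<open>u \<in> carr A\<close> subspace_annihilated]) (auto simp: K_carr K_bracket)
  then show ?case by simp
next
  case (Suc k)
  show ?case
    using leibniz[of u "rpow x (Suc k) y" x] Suc.IH[of u] Suc.IH[of "u \<odot> x"] Suc.prems by simp
qed

text \<open>
  The central element \<open>[x,x] - [y,x]\<close> dies after one more multiplication by \<open>x\<close>, so the powers of \<open>x\<close>
  join the products \<open>[y x\<^sup>k]\<close> from the third one on.
\<close>

lemma chain_eq: "rpow x (Suc (Suc k)) x = rpow x (Suc (Suc k)) y"
  by (induction k) (simp_all add: xx bracket_add_left)

lemma bracket_x_chain: "u \<in> carr A \<Longrightarrow> u \<odot> rpow x (Suc k) x = 0"
  using bracket_chain[of u k] bracket_chain[of u 0] chain_eq[of "k - 1"]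
  by (cases k) (simp_all add: xx bracket_add_right)

lemma x_chain_bracket_y: "rpow x (Suc k) x \<odot> y = 0"
  using chain_bracket_y[of k] chain_bracket_y[of 0] chain_eq[of "k - 1"]
  by (cases k) (simp_all add: xx bracket_add_left)

lemma x_chain_end: "rpow x (n - 1) x = w2 x y"
proof -
  have "n - 1 = Suc (Suc (n - 3))" using n by arith
  then show ?thesis using chain_eq[of "n - 3"] by (simp add: w2_def del: rpow.simps)
qed

text \<open>
  By the vanishing results above, the products of the spanning elements are the
  \<open>[y x\<^sup>k]\<close> with \<open>0 < k < n\<close>, the last of which is \<open>w2\<close>, and combinations of \<open>w1\<close>, \<open>w3\<close>, \<open>w4\<close>
  with them. Since \<open>K\<close> lies in the derived algebra, this also bounds \<open>K\<close>.
\<close>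

lemma derived_span:
  "derived \<subseteq> span ((\<lambda>k. rpow x (Suc k) y) ` {..<n - 2} \<union> {w1 x y, w2 x y, w3 x y, w4 x y})"
  (is "_ \<subseteq> span ?D")
proof -
  let ?S = "span ?D"
  have in_S: "v \<in> ?S" if "v \<in> ?D" for v using that by (rule span_base)
  have w: "w1 x y \<in> ?S" "w2 x y \<in> ?S" "w3 x y \<in> ?S" "w4 x y \<in> ?S"
    by (rule in_S, simp)+
  have chain: "rpow x (Suc k) y \<in> ?S" if "k < n - 1" for k
  proof (cases "k < n - 2")
    case True then show ?thesis by (intro in_S) blast
  next
    case False
    then have "Suc k = n - 1" using that by linarith
    then have "rpow x (Suc k) y = w2 x y" by (simp add: w2_def del: rpow.simps)
    then show ?thesis using w by (simp del: rpow.simps)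
  qed
  have sub_r: "subspace {v \<in> carr A. u \<odot> v \<in> ?S}" if "u \<in> carr A" for u
    using that by (intro subspaceI) (auto simp: bracket_bilinear span_zero span_add span_scale)
  have sub_l: "subspace {u \<in> carr A. u \<odot> v \<in> ?S}" if "v \<in> carr A" for v
    using that by (intro subspaceI) (auto simp: bracket_bilinear span_zero span_add span_scale)
  have by_x: "u \<odot> x \<in> ?S" if "u \<in> carr A" for u
  proof -
    have "x \<odot> x \<in> ?S" using chain[of 0] w n by (simp add: xx span_add)
    then have "u \<in> {u \<in> carr A. u \<odot> x \<in> ?S}"
      using chain
      by (intro adapted_induct[OF that sub_l]) (auto simp: K_carr K_bracket span_zero)
    then show ?thesis by simp
  qed
  have by_y: "u \<odot> y \<in> ?S" if "u \<in> carr A" for u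
  proof -
    have "rpow x k y \<odot> y \<in> ?S" for k
      using w chain_bracket_y[of "k - 1"] by (cases k) (simp_all add: xy_yy span_zero)
    then have "u \<in> {u \<in> carr A. u \<odot> y \<in> ?S}"
      using w
      by (intro adapted_induct[OF that sub_l]) (auto simp: K_carr K_bracket span_zero xy_yy)
    then show ?thesis by simp
  qed
  have "u \<odot> v \<in> ?S" if "u \<in> carr A" "v \<in> carr A" for u v
  proof -
    have "u \<odot> rpow x k y \<in> ?S" for k
      using by_y[OF that(1)] bracket_chain[OF that(1), of "k - 1"]
      by (cases k) (simp_all add: span_zero)
    then have "v \<in> {v \<in> carr A. u \<odot> v \<in> ?S}"
      using that(1) by_x[OF that(1)]
      by (intro adapted_induct[OF that(2) sub_r[OF that(1)]]) (auto simp: K_carr K_bracket span_zero)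
    then show ?thesis by simp
  qed
  then show ?thesis
    unfolding derived_def by (intro span_minimal) auto
qed

lemma adapted_span:
  assumes "subspace S" "x \<in> S" "y \<in> S" "\<And>k. k < n - 2 \<Longrightarrow> rpow x (Suc k) y \<in> S"
    and "w1 x y \<in> S" "w2 x y \<in> S" "w3 x y \<in> S" "w4 x y \<in> S"
  shows "carr A \<subseteq> S"
proof
  fix u assume "u \<in> carr A"
  have "span ((\<lambda>k. rpow x (Suc k) y) ` {..<n - 2} \<union> {w1 x y, w2 x y, w3 x y, w4 x y}) \<subseteq> S"
    using assms by (intro span_minimal) auto
  then have "K \<subseteq> S" using derived_span K_derived by blast
  moreover have "rpow x k y \<in> S" if "k < n - 1" for k
    using that assms(3) assms(4)[of "k - 1"] by (cases k) (auto simp del: rpow.simps(2))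
  ultimately show "u \<in> S"
    using assms(2) by (intro adapted_induct[OF \<open>u \<in> carr A\<close> assms(1)])
qed

text \<open>
  Four vectors in the three-dimensional space \<open>K\<close> are dependent.
\<close>

lemma adapted_relation:
  obtains p1 p2 p3 p4 where
    "p1 *\<^sub>s w1 x y + p2 *\<^sub>s w2 x y + p3 *\<^sub>s w3 x y + p4 *\<^sub>s w4 x y = 0"
    "p1 \<noteq> 0 \<or> p2 \<noteq> 0 \<or> p3 \<noteq> 0 \<or> p4 \<noteq> 0"
proof -
  obtain B where B: "finite B" "span B = K" "card B = 3"
    using finite_basis_of_subspace[OF K_subspace] K_carr dim_K by (metis subsetI)
  let ?b = "\<lambda>i::nat. if i = 1 then w1 x y else if i = 2 then w2 x y else if i = 3 then w3 x y else w4 x y"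
  have "?b ` {1..4::nat} \<subseteq> span B" using B(2) by auto
  then obtain c i where c: "(\<Sum>i=1..4. c i *\<^sub>s ?b i) = 0" "i \<in> {1..4}" "c i \<noteq> 0"
    using dependent_family[OF B(1), of ?b 4] B(3) by auto
  have "{1..4::nat} = {1, 2, 3, 4}" by auto
  then show thesis
    using that[of "c 1" "c 2" "c 3" "c 4"] c by (auto simp: add.assoc)
qed

text \<open>
  The coefficient \<open>a + b\<close> of \<open>y'\<close> is forced: the parts of \<open>[x',x']\<close> and \<open>[y',x']\<close> along \<open>[y,x]\<close>
  have coefficients \<open>a (a + b)\<close> and \<open>a d\<close> if \<open>y' = d y\<close>. The summand \<open>[y x\<^sup>n\<^sup>-\<^sup>2]\<close> in \<open>x'\<close> serves to
  shift \<open>w1\<close> by a multiple of \<open>w2\<close>. In the chain of \<open>y'\<close>, the multiple of \<open>w4\<close>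
  that appears in \<open>[y',x']\<close> is central and disappears at the next step.
\<close>

lemma adapted_change:
  fixes a b c :: complex
  assumes a: "a \<noteq> 0" "a + b \<noteq> 0"
  defines "x' \<equiv> a *\<^sub>s x + b *\<^sub>s y + c *\<^sub>s rpow x (n - 2) y" and "y' \<equiv> (a + b) *\<^sub>s y"
  shows "adapted x' y'"
    and "w1 x' y' = a\<^sup>2 *\<^sub>s w1 x y + (a * c) *\<^sub>s w2 x y + (a * b) *\<^sub>s (w3 x y - w4 x y)"
    and "w2 x' y' = ((a + b) * a ^ (n - 1)) *\<^sub>s w2 x y"
    and "w3 x' y' = (a + b) *\<^sub>s (a *\<^sub>s w3 x y + b *\<^sub>s w4 x y)"
    and "w4 x' y' = (a + b)\<^sup>2 *\<^sub>s w4 x y"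
proof -
  obtain j where j: "n - 2 = Suc j" "n - 1 = Suc (Suc j)"
    using n by (cases "n - 2") auto
  let ?z = "rpow x (n - 2) y"
  have z: "?z \<odot> y = 0" "?z \<odot> x = w2 x y" "u \<in> carr A \<Longrightarrow> u \<odot> ?z = 0" for u
    using chain_bracket_y bracket_chain unfolding j w2_def by (simp_all only: rpow.simps)
  have carr [simp]: "x' \<in> carr A" "y' \<in> carr A" by (simp_all add: x'_def y'_def)
  have by_x': "u \<odot> x' = a *\<^sub>s (u \<odot> x) + b *\<^sub>s (u \<odot> y)" if "u \<in> carr A" for u
    using that by (simp add: x'_def bracket_bilinear z)
  have x'_by: "x' \<odot> x = a *\<^sub>s w1 x y + (a + b) *\<^sub>s (y \<odot> x) + c *\<^sub>s w2 x y"
    "x' \<odot> y = a *\<^sub>s w3 x y + b *\<^sub>s w4 x y"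
    by (simp_all add: x'_def bracket_bilinear z xx xy_yy algebra_simps)
  show w3: "w3 x' y' = (a + b) *\<^sub>s (a *\<^sub>s w3 x y + b *\<^sub>s w4 x y)"
    by (simp add: w3_def[of x'] y'_def bracket_bilinear x'_by)
  show w4: "w4 x' y' = (a + b)\<^sup>2 *\<^sub>s w4 x y"
    by (simp add: w4_def[of x'] y'_def bracket_bilinear xy_yy power2_eq_square)
  have y'x': "y' \<odot> x' = ((a + b) * a) *\<^sub>s (y \<odot> x) + ((a + b) * b) *\<^sub>s w4 x y"
    by (simp add: by_x' y'_def bracket_bilinear xy_yy mult.commute)
  show w1: "w1 x' y' = a\<^sup>2 *\<^sub>s w1 x y + (a * c) *\<^sub>s w2 x y + (a * b) *\<^sub>s (w3 x y - w4 x y)"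
    unfolding w1_def[of x'] y'x' by (simp add: by_x' x'_by algebra_simps power2_eq_square)
  have chain': "rpow x' (Suc (Suc k)) y' = ((a + b) * a ^ Suc (Suc k)) *\<^sub>s rpow x (Suc (Suc k)) y" for k
  proof (induction k)
    case 0
    have "(y' \<odot> x') \<odot> x' = ((a + b) * a * a) *\<^sub>s ((y \<odot> x) \<odot> x)"
      unfolding y'x' using chain_bracket_y[of 0]
      by (simp add: by_x' bracket_bilinear mult.commute)
    then show ?case by (simp add: algebra_simps)
  next
    case (Suc k)
    have "rpow x' (Suc (Suc (Suc k))) y' = (((a + b) * a ^ Suc (Suc k)) *\<^sub>s rpow x (Suc (Suc k)) y) \<odot> x'"
      using Suc.IH by simp
    also have "\<dots> = ((a + b) * a ^ Suc (Suc k)) *\<^sub>s (a *\<^sub>s (rpow x (Suc (Suc k)) y \<odot> x))"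
      using chain_bracket_y[of "Suc k"] by (simp add: bracket_bilinear by_x')
    finally show ?case by (simp add: algebra_simps)
  qed
  show w2: "w2 x' y' = ((a + b) * a ^ (n - 1)) *\<^sub>s w2 x y"
    unfolding w2_def j(2) by (rule chain')
  have K_lin: "u \<in> K \<Longrightarrow> v \<in> K \<Longrightarrow> u + v \<in> K" "u \<in> K \<Longrightarrow> v \<in> K \<Longrightarrow> u - v \<in> K"
    "u \<in> K \<Longrightarrow> r *\<^sub>s u \<in> K" for u v r
    using K_subspace by (simp_all add: subspace_add subspace_diff subspace_scale)
  let ?S = "span (insert x' ((\<lambda>k. rpow x' k y') ` {..<n - 1}) \<union> K)"
  have x'_S: "x' \<in> ?S" by (rule span_base) simp
  have unscale: "v \<in> ?S" if "r *\<^sub>s v \<in> ?S" "r \<noteq> 0" for r v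
    using span_scale[OF that(1), of "inverse r"] that(2) by simp
  have K_S: "v \<in> ?S" if "v \<in> K" for v by (rule span_base) (use that in simp)
  have chain'_S: "rpow x' k y' \<in> ?S" if "k < n - 1" for k
    by (rule span_base, rule UnI1, rule insertI2, rule imageI) (use that in simp)
  have y_S: "y \<in> ?S"
  proof (rule unscale)
    show "(a + b) *\<^sub>s y \<in> ?S" using chain'_S[of 0] n by (simp add: y'_def)
  qed (rule a)
  have chain_S: "rpow x (Suc k) y \<in> ?S" if k: "k < n - 2" for k
  proof (cases k)
    case 0
    have "y' \<odot> x' \<in> ?S" using chain'_S[of 1] n by simp
    then have "y' \<odot> x' - ((a + b) * b) *\<^sub>s w4 x y \<in> ?S"
      by (rule span_diff[OF _ span_scale[OF K_S]]) simp
    then have "((a + b) * a) *\<^sub>s (y \<odot> x) \<in> ?S" unfolding y'x' by simp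
    then have "y \<odot> x \<in> ?S" by (rule unscale) (use a in simp)
    then show ?thesis using 0 by simp
  next
    case (Suc i)
    have "rpow x' (Suc k) y' \<in> ?S" using k by (intro chain'_S) simp
    then show ?thesis unfolding Suc chain' by (rule unscale) (use a in simp)
  qed
  have "x' - b *\<^sub>s y - c *\<^sub>s ?z \<in> ?S"
    unfolding j(1) by (intro span_diff span_scale x'_S y_S chain_S) (simp add: j(1))
  then have "a *\<^sub>s x \<in> ?S" by (simp add: x'_def)
  then have "x \<in> ?S" by (rule unscale) (rule a)
  then have "carr A \<subseteq> ?S"
    by (rule adapted_span[OF subspace_span _ y_S]) ((rule chain_S, assumption) | (rule K_S, simp))+
  then show "adapted x' y'"
    unfolding adapted_def w1 w2 w3 w4 by (simp add: K_lin)
qed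

end

end

section \<open>Recognising the algebras of the list\<close>

context filiform_extension
begin

text \<open>
  The algebra has dimension at least \<open>n + 3\<close>, so \<open>n + 3\<close> spanning elements form a basis.
\<close>

lemma alg_isomorphic_table_alg_if_spanning:
  fixes b :: "nat \<Rightarrow> 'a"
  assumes "\<And>i. i \<in> {1..n + 3} \<Longrightarrow> b i \<in> carr A"
    and span: "carr A \<subseteq> span (b ` {1..n + 3})"
    and "\<And>i j k. i \<in> {1..n + 3} \<Longrightarrow> j \<in> {1..n + 3} \<Longrightarrow> k \<notin> {1..n + 3} \<Longrightarrow> T i j k = 0"
    and "\<And>i j. i \<in> {1..n + 3} \<Longrightarrow> j \<in> {1..n + 3} \<Longrightarrow>
      b i \<odot> b j = (\<Sum>k=1..n + 3. T i j k *\<^sub>s b k)"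
  shows "A \<cong>\<^sub>a table_alg (n + 3) T"
proof (rule alg_isomorphic_table_alg)
  obtain B where "B \<subseteq> carr A" "independent B" "card B = dim (carr A)"
    using basis_exists by metis
  then show "inj_on b {1..n + 3}" "independent (b ` {1..n + 3})"
    using spanning_family_independent[of B b "n + 3"] span dim_A by auto
  show "span (b ` {1..n + 3}) = carr A"
    using assms(1) span carr_subspace by (intro subset_antisym span_minimal) auto
qed fact+

lemma sum_e_scale:
  assumes "i \<in> {1..m}"
  shows "(\<Sum>k=1..m. e i k *\<^sub>s b k) = b i"
proof -
  have "(\<Sum>k=1..m. e i k *\<^sub>s b k) = (\<Sum>k=1..m. if k = i then b i else 0)"
    by (rule sum.cong) (auto simp: e_def)
  then show ?thesis using assms by simp
qed

lemma sum_scale_linear: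
  "(\<Sum>k=1..m. (s + t :: nat \<Rightarrow> complex) k *\<^sub>s b k) = (\<Sum>k=1..m. s k *\<^sub>s b k) + (\<Sum>k=1..m. t k *\<^sub>s b k)"
  "(\<Sum>k=1..m. cscale c t k *\<^sub>s b k) = c *\<^sub>s (\<Sum>k=1..m. t k *\<^sub>s b k)"
  "(\<Sum>k=1..m. (0 :: nat \<Rightarrow> complex) k *\<^sub>s b k) = 0"
  by (simp_all add: scale_left_distrib sum.distrib cscale_apply scale_sum_right)

lemma bracket_neg: "u \<in> carr A \<Longrightarrow> v \<in> carr A \<Longrightarrow> (- u) \<odot> v = - (u \<odot> v)"
  "u \<in> carr A \<Longrightarrow> v \<in> carr A \<Longrightarrow> v \<odot> (- u) = - (v \<odot> u)"
  using bracket_diff_left[of 0 u v] bracket_diff_right[of v 0 u] by simp_all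

text \<open>
  The relation expresses \<open>w4\<close> through the other three, so the \<open>n\<close> powers of \<open>x\<close>, which include
  \<open>w2\<close> as the last one, together with \<open>y\<close>, \<open>- w1\<close> and \<open>w3\<close> span the algebra.
\<close>

lemma alg_isomorphic_P:
  assumes xy: "adapted x y"
    and rel: "w4 x y = \<alpha> *\<^sub>s w2 x y - \<beta> *\<^sub>s w1 x y + \<gamma> *\<^sub>s w3 x y"
  shows "A \<cong>\<^sub>a P n \<alpha> \<beta> \<gamma>"
proof -
  note [simp] = adapted_simps[OF xy] w_carr[OF xy] w_bracket[OF xy]
  define b where "b i = (if i \<le> n then rpow x (i - 1) x else if i = n + 1 then y
    else if i = n + 2 then - w1 x y else w3 x y)" for i
  have b1: "b 1 = x" and b_y: "b (n + 1) = y" and b2: "b (n + 2) = - w1 x y"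
    and b3: "b (n + 3) = w3 x y"
    using n by (simp_all add: b_def)
  have b_Suc: "b (Suc i) = b i \<odot> x" if "1 \<le> i" "i \<le> n - 1" for i
  proof -
    have "Suc i \<le> n" using that n by linarith
    then show ?thesis using that(1) by (cases i) (simp_all add: b_def)
  qed
  have b_n: "b n = w2 x y"
    using x_chain_end[OF xy] n by (simp add: b_def)
  have bracket_b: "u \<odot> b i = 0" if "2 \<le> i" "i \<noteq> n + 1" "u \<in> carr A" for u i
  proof (cases "i \<le> n")
    case True
    moreover have "i - 1 = Suc (i - 2)" using that(1) by linarith
    ultimately have "b i = rpow x (Suc (i - 2)) x" unfolding b_def by (simp only: if_True)
    then show ?thesis using bracket_x_chain[OF xy that(3)] by simp
  next
    case False
    then show ?thesis using that by (auto simp: b_def bracket_neg)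
  qed
  have b_bracket_y: "b i \<odot> y = 0" if "2 \<le> i" "i \<noteq> n + 1" for i
  proof (cases "i \<le> n")
    case True
    moreover have "i - 1 = Suc (i - 2)" using that(1) by linarith
    ultimately have "b i = rpow x (Suc (i - 2)) x" unfolding b_def by (simp only: if_True)
    then show ?thesis using x_chain_bracket_y[OF xy] by simp
  next
    case False
    then show ?thesis using that by (auto simp: b_def bracket_neg)
  qed
  have b_bracket_x: "b i \<odot> x = 0" if "n \<le> i" "i \<noteq> n + 1" for i
    using that b_n by (cases "i = n") (auto simp: b_def bracket_neg)
  have b_carr: "b i \<in> carr A" for i by (simp add: b_def)
  define G where "G t = (\<Sum>k=1..n + 3. t k *\<^sub>s b k)" for t
  have G_e: "G (e i) = b i" if "1 \<le> i" "i \<le> n + 3" for i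
    unfolding G_def using that by (intro sum_e_scale) simp
  have G_lin: "G (s + t) = G s + G t" "G (cscale c t) = c *\<^sub>s G t" "G 0 = 0" for s t c
    unfolding G_def by (rule sum_scale_linear)+
  show ?thesis
    unfolding P_def
  proof (rule alg_isomorphic_table_alg_if_spanning[of b])
    show "carr A \<subseteq> span (b ` {1..n + 3})"
    proof (rule adapted_span[OF xy])
      let ?S = "span (b ` {1..n + 3})"
      have b_S: "b i \<in> ?S" if "1 \<le> i" "i \<le> n + 3" for i
        using that by (intro span_base imageI) simp
      show "subspace ?S" by simp
      show x: "x \<in> ?S" using b_S[of 1] b1 by simp
      show "y \<in> ?S" using b_S[of "n + 1"] b_y by simp
      show w1: "w1 x y \<in> ?S" using span_neg[OF b_S[of "n + 2"]] b2 by simp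
      show w2: "w2 x y \<in> ?S" using b_S[of n] b_n n by simp
      show w3: "w3 x y \<in> ?S" using b_S[of "n + 3"] b3 by simp
      show "w4 x y \<in> ?S" unfolding rel by (intro span_add span_diff span_scale w1 w2 w3)
      fix k assume k: "k < n - 2"
      have "k + 2 \<le> n" using k by linarith
      then have "b (k + 2) = rpow x (Suc k) x" by (simp add: b_def)
      then have "rpow x (Suc k) x \<in> ?S" using b_S[of "k + 2"] \<open>k + 2 \<le> n\<close> by simp
      then show "rpow x (Suc k) y \<in> ?S"
        using w1 chain_eq[OF xy, of "k - 1"] span_diff[of "x \<odot> x" _ "w1 x y"]
        by (cases k) (auto simp: xx[OF xy])
    qed
  next
    fix i j assume ij: "i \<in> {1..n + 3}" "j \<in> {1..n + 3}"
    have *: "b i \<odot> b j =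
      (if 1 \<le> i \<and> i \<le> n - 1 \<and> j = 1 then b (i + 1)
       else if i = n + 1 \<and> j = 1 then b 2 + b (n + 2)
       else if i = 1 \<and> j = n + 1 then b (n + 3)
       else if i = n + 1 \<and> j = n + 1 then
         \<alpha> *\<^sub>s b n + \<beta> *\<^sub>s b (n + 2) + \<gamma> *\<^sub>s b (n + 3)
       else 0)"
    proof -
      have "j = 1 \<or> j = n + 1 \<or> 2 \<le> j \<and> j \<noteq> n + 1" using ij by auto
      moreover have "i = 1 \<or> i = n + 1 \<or> 2 \<le> i \<and> i \<noteq> n + 1" using ij by auto
      moreover have "i \<le> n - 1 \<or> i = n + 1 \<or> n \<le> i \<and> i \<noteq> n + 1" by linarith
      ultimately consider "j = 1" "i \<le> n - 1" | "j = 1" "i = n + 1" | "j = 1" "n \<le> i" "i \<noteq> n + 1"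
        | "j = n + 1" "i = 1" | "j = n + 1" "i = n + 1" | "j = n + 1" "2 \<le> i" "i \<noteq> n + 1"
        | "2 \<le> j" "j \<noteq> n + 1"
        by blast
      then show ?thesis
      proof cases
        case 1
        then show ?thesis using ij n b_Suc[of i] by (simp add: b1[unfolded One_nat_def])
      next
        case 2
        have "b 2 = x \<odot> x" using b_Suc[of 1] b1 n by (simp add: numeral_2_eq_2)
        then have "b i \<odot> b j = b 2 + b (n + 2)"
          unfolding 2 b1 b2 b_y xx[OF xy] by simp
        moreover have "\<not> n + 1 \<le> n - 1" by simp
        ultimately show ?thesis using 2 by (simp del: One_nat_def)
      next
        case 3
        have "b i \<odot> b j = 0" unfolding 3 b1 by (rule b_bracket_x[OF 3(2,3)])
        moreover have "\<not> i \<le> n - 1" "1 \<noteq> n + 1" using 3 n by linarith+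
        ultimately show ?thesis using 3 by (simp del: One_nat_def)
      next
        case 4
        have "b i \<odot> b j = b (n + 3)" unfolding 4 b1 b_y b3 xy_yy[OF xy] ..
        moreover have "n + 1 \<noteq> 1" using n by linarith
        ultimately show ?thesis using 4 by (simp del: One_nat_def)
      next
        case 5
        have "b i \<odot> b j = \<alpha> *\<^sub>s b n + \<beta> *\<^sub>s b (n + 2) + \<gamma> *\<^sub>s b (n + 3)"
          unfolding 5 b_y b_n b2 b3 xy_yy[OF xy] rel by simp
        moreover have "n + 1 \<noteq> 1" using n by linarith
        ultimately show ?thesis using 5 by (simp del: One_nat_def)
      next
        case 6
        have "b i \<odot> b j = 0" unfolding 6 b_y by (rule b_bracket_y[OF 6(2,3)])
        moreover have "n + 1 \<noteq> 1" "i \<noteq> 1" using 6 n by linarith+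
        ultimately show ?thesis using 6 by (simp del: One_nat_def)
      next
        case 7
        have "b i \<odot> b j = 0" by (rule bracket_b[OF 7 b_carr])
        moreover have "j \<noteq> 1" using 7 by linarith
        ultimately show ?thesis using 7 by (simp del: One_nat_def)
      qed
    qed
    have "b i \<odot> b j = G
      (if 1 \<le> i \<and> i \<le> n - 1 \<and> j = 1 then e (i + 1)
       else if i = n + 1 \<and> j = 1 then e 2 + e (n + 2)
       else if i = 1 \<and> j = n + 1 then e (n + 3)
       else if i = n + 1 \<and> j = n + 1 then
         cscale \<alpha> (e n) + cscale \<beta> (e (n + 2)) + cscale \<gamma> (e (n + 3))
       else 0)"
      unfolding * using n
      by (simp only: if_distrib[of G] G_lin cong: if_cong) (intro if_cong refl; auto simp: G_e)
    then show "b i \<odot> b j = (\<Sum>k = 1..n + 3.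
      (if 1 \<le> i \<and> i \<le> n - 1 \<and> j = 1 then e (i + 1)
       else if i = n + 1 \<and> j = 1 then e 2 + e (n + 2)
       else if i = 1 \<and> j = n + 1 then e (n + 3)
       else if i = n + 1 \<and> j = n + 1 then
         cscale \<alpha> (e n) + cscale \<beta> (e (n + 2)) + cscale \<gamma> (e (n + 3))
       else 0) k *\<^sub>s b k)"
      unfolding G_def .
  qed (use n in \<open>auto simp: b_carr e_def cscale_apply\<close>)
qed

end

context filiform_extension
begin

text \<open>
  If \<open>w2 = 0\<close>, the powers of \<open>x\<close> end one step earlier, at \<open>n - 1\<close>, and \<open>w4\<close> takes the place that
  becomes free.
\<close>

lemma alg_isomorphic_Pstar:
  assumes xy: "adapted x y" and w2_0: "w2 x y = 0"
  shows "A \<cong>\<^sub>a Pstar n"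
proof -
  note [simp] = adapted_simps[OF xy] w_carr[OF xy] w_bracket[OF xy]
  define b where "b i = (if i < n then rpow x (i - 1) x else if i = n then y
    else if i = n + 1 then - w1 x y else if i = n + 2 then w3 x y else w4 x y)" for i
  have b1: "b 1 = x" and b_y: "b n = y" and b2: "b (n + 1) = - w1 x y"
    and b3: "b (n + 2) = w3 x y" and b4: "b (n + 3) = w4 x y"
    using n by (simp_all add: b_def)
  have b_Suc: "b (Suc i) = b i \<odot> x" if "1 \<le> i" "i \<le> n - 2" for i
  proof -
    have "Suc i < n" using that n by linarith
    then show ?thesis using that(1) by (cases i) (simp_all add: b_def)
  qed
  have b_n: "b (n - 1) \<odot> x = 0"
  proof -
    have "n - 1 = Suc (n - 2)" using n by linarith
    then show ?thesis using x_chain_end[OF xy] w2_0 n by (simp add: b_def)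
  qed
  have chain: "b i = rpow x (Suc (i - 2)) x" if "2 \<le> i" "i < n" for i
  proof -
    have "i - 1 = Suc (i - 2)" using that(1) by linarith
    then show ?thesis unfolding b_def using that(2) by (simp only: if_True)
  qed
  have bracket_b: "u \<odot> b i = 0" if "2 \<le> i" "i \<noteq> n" "u \<in> carr A" for u i
  proof (cases "i < n")
    case True
    then show ?thesis using bracket_x_chain[OF xy that(3)] chain that(1) by simp
  next
    case False
    then show ?thesis using that by (auto simp: b_def bracket_neg)
  qed
  have b_bracket_y: "b i \<odot> y = 0" if "2 \<le> i" "i \<noteq> n" for i
  proof (cases "i < n")
    case True
    then show ?thesis using x_chain_bracket_y[OF xy] chain that(1) by simp
  next
    case False
    then show ?thesis using that by (auto simp: b_def bracket_neg)
  qed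
  have b_bracket_x: "b i \<odot> x = 0" if "n - 1 \<le> i" "i \<noteq> n" for i
    using that b_n by (cases "i = n - 1") (auto simp: b_def bracket_neg)
  have b_carr: "b i \<in> carr A" for i by (simp add: b_def)
  define G where "G t = (\<Sum>k=1..n + 3. t k *\<^sub>s b k)" for t
  have G_e: "G (e i) = b i" if "1 \<le> i" "i \<le> n + 3" for i
    unfolding G_def using that by (intro sum_e_scale) simp
  have G_lin: "G (s + t) = G s + G t" "G (cscale c t) = c *\<^sub>s G t" "G 0 = 0" for s t c
    unfolding G_def by (rule sum_scale_linear)+
  show ?thesis
    unfolding Pstar_def
  proof (rule alg_isomorphic_table_alg_if_spanning[of b])
    show "carr A \<subseteq> span (b ` {1..n + 3})"
    proof (rule adapted_span[OF xy])
      let ?S = "span (b ` {1..n + 3})"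
      have b_S: "b i \<in> ?S" if "1 \<le> i" "i \<le> n + 3" for i
        using that by (intro span_base imageI) simp
      show "subspace ?S" by simp
      show x: "x \<in> ?S" using b_S[of 1] b1 by simp
      show "y \<in> ?S" using b_S[of n] b_y n by simp
      show w1: "w1 x y \<in> ?S" using span_neg[OF b_S[of "n + 1"]] b2 by simp
      show "w2 x y \<in> ?S" unfolding w2_0 by (rule span_zero)
      show "w3 x y \<in> ?S" using b_S[of "n + 2"] b3 by simp
      show "w4 x y \<in> ?S" using b_S[of "n + 3"] b4 by simp
      fix k assume k: "k < n - 2"
      have le: "k + 2 < n" using k by linarith
      then have "b (k + 2) = rpow x (Suc k) x" by (simp add: b_def)
      moreover have "k + 2 \<le> n + 3" using k by linarith
      ultimately have "rpow x (Suc k) x \<in> ?S" using b_S[of "k + 2"] by simp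
      then show "rpow x (Suc k) y \<in> ?S"
        using w1 chain_eq[OF xy, of "k - 1"] span_diff[of "x \<odot> x" _ "w1 x y"]
        by (cases k) (auto simp: xx[OF xy])
    qed
  next
    fix i j assume ij: "i \<in> {1..n + 3}" "j \<in> {1..n + 3}"
    have *: "b i \<odot> b j =
      (if 1 \<le> i \<and> i \<le> n - 2 \<and> j = 1 then b (i + 1)
       else if i = n \<and> j = 1 then b 2 + b (n + 1)
       else if i = 1 \<and> j = n then b (n + 2)
       else if i = n \<and> j = n then b (n + 3)
       else 0)"
    proof -
      have "j = 1 \<or> j = n \<or> 2 \<le> j \<and> j \<noteq> n" using ij by auto
      moreover have "i = 1 \<or> i = n \<or> 2 \<le> i \<and> i \<noteq> n" using ij by auto
      moreover have "i \<le> n - 2 \<or> i = n \<or> n - 1 \<le> i \<and> i \<noteq> n" by linarith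
      ultimately consider "j = 1" "i \<le> n - 2" | "j = 1" "i = n" | "j = 1" "n - 1 \<le> i" "i \<noteq> n"
        | "j = n" "i = 1" | "j = n" "i = n" | "j = n" "2 \<le> i" "i \<noteq> n"
        | "2 \<le> j" "j \<noteq> n"
        by blast
      then show ?thesis
      proof cases
        case 1
        then show ?thesis using ij n b_Suc[of i] by (simp add: b1[unfolded One_nat_def])
      next
        case 2
        have "b 2 = x \<odot> x" using b_Suc[of 1] b1 n by (simp add: numeral_2_eq_2)
        then have "b i \<odot> b j = b 2 + b (n + 1)"
          unfolding 2 b1 b2 b_y xx[OF xy] by simp
        moreover have "\<not> n \<le> n - 2" using n by linarith
        ultimately show ?thesis using 2 by (simp del: One_nat_def)
      next
        case 3
        have "b i \<odot> b j = 0" unfolding 3 b1 by (rule b_bracket_x[OF 3(2,3)])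
        moreover have "\<not> i \<le> n - 2" "1 \<noteq> n" using 3 n by linarith+
        ultimately show ?thesis using 3 by (simp del: One_nat_def)
      next
        case 4
        have "b i \<odot> b j = b (n + 2)" unfolding 4 b1 b_y b3 xy_yy[OF xy] ..
        moreover have "n \<noteq> 1" using n by linarith
        ultimately show ?thesis using 4 by (simp del: One_nat_def)
      next
        case 5
        have "b i \<odot> b j = b (n + 3)" unfolding 5 b_y b4 xy_yy[OF xy] ..
        moreover have "n \<noteq> 1" using n by linarith
        ultimately show ?thesis using 5 by (simp del: One_nat_def)
      next
        case 6
        have "b i \<odot> b j = 0" unfolding 6 b_y by (rule b_bracket_y[OF 6(2,3)])
        moreover have "n \<noteq> 1" "i \<noteq> 1" using 6 n by linarith+
        ultimately show ?thesis using 6 by (simp del: One_nat_def)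
      next
        case 7
        have "b i \<odot> b j = 0" by (rule bracket_b[OF 7 b_carr])
        moreover have "j \<noteq> 1" using 7 by linarith
        ultimately show ?thesis using 7 by (simp del: One_nat_def)
      qed
    qed
    have "b i \<odot> b j = G
      (if 1 \<le> i \<and> i \<le> n - 2 \<and> j = 1 then e (i + 1)
       else if i = n \<and> j = 1 then e 2 + e (n + 1)
       else if i = 1 \<and> j = n then e (n + 2)
       else if i = n \<and> j = n then e (n + 3)
       else 0)"
      unfolding * using n
      by (simp only: if_distrib[of G] G_lin cong: if_cong) (intro if_cong refl; auto simp: G_e)
    then show "b i \<odot> b j = (\<Sum>k = 1..n + 3.
      (if 1 \<le> i \<and> i \<le> n - 2 \<and> j = 1 then e (i + 1)
       else if i = n \<and> j = 1 then e 2 + e (n + 1)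
       else if i = 1 \<and> j = n then e (n + 2)
       else if i = n \<and> j = n then e (n + 3)
       else 0) k *\<^sub>s b k)"
      unfolding G_def .
  qed (use n in \<open>auto simp: b_carr e_def\<close>)
qed

end

section \<open>Normal forms of the relation\<close>

text \<open>
  With \<open>a + b = a t\<close>, the formulas of \<open>adapted_change\<close> turn the relation with parameters
  \<open>(\<alpha>, \<beta>, \<gamma>)\<close> into the one with \<open>(\<alpha>', \<beta>', \<gamma>')\<close> exactly if the three equations hold (there \<open>m\<close>
  is \<open>n - 2\<close>, and \<open>a c\<close> is the coefficient of \<open>[y x\<^sup>n\<^sup>-\<^sup>2]\<close>). The second and third equation do not
  involve \<open>a\<close> and \<open>c\<close>; they are solved first, by the choice of \<open>t\<close>. After that, \<open>\<alpha>\<close> is normalised to 0 by \<open>c\<close> if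
  \<open>\<beta> \<noteq> 0\<close>; if \<open>\<beta> = 0\<close> a nonzero \<open>\<alpha>\<close> is normalised to 1, through an \<open>m\<close>-th root if \<open>\<gamma> \<noteq> 0\<close>
  and through \<open>t\<close> if \<open>\<gamma> = 0\<close>.
\<close>

lemma P_change_of_parameters:
  fixes \<alpha> \<beta> \<gamma> :: complex
  assumes "0 < m"
  obtains \<alpha>' \<beta>' \<gamma>' a t c where "(\<alpha>', \<beta>', \<gamma>') \<in> P_params" "a \<noteq> 0" "t \<noteq> 0"
    "(t\<^sup>2 - \<beta>' * (t - 1) - \<gamma>' * t * (t - 1)) * \<alpha> = \<alpha>' * t * a ^ m - \<beta>' * c"
    "(t\<^sup>2 - \<beta>' * (t - 1) - \<gamma>' * t * (t - 1)) * \<beta> = \<beta>'"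
    "(t\<^sup>2 - \<beta>' * (t - 1) - \<gamma>' * t * (t - 1)) * \<gamma> = \<gamma>' * t - \<beta>' * (t - 1)"
proof -
  have root: "\<exists>a. a \<noteq> 0 \<and> a ^ m = z" if "z \<noteq> 0" for z :: complex
  proof -
    have "{a. a ^ m = z} \<noteq> {}"
      using card_nth_roots[OF that assms] assms by (metis card.empty less_numeral_extra(3))
    then show ?thesis using that assms by (auto simp: zero_power)
  qed
  show thesis
  proof (cases "\<beta> = 0")
    case \<beta>: True
    show thesis
    proof (cases "\<gamma> = 0")
      case \<gamma>: True
      show thesis
      proof (cases "\<alpha> = 0")
        case True
        show thesis
          by (rule that[of 0 0 0 1 1 0]) (use \<beta> \<gamma> True in \<open>auto simp: P_params_def\<close>)
      next
        case False
        show thesis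
          by (rule that[of 1 0 0 1 "1 / \<alpha>" 0])
            (use \<beta> \<gamma> False in \<open>auto simp: P_params_def field_simps power2_eq_square\<close>)
      qed
    next
      case \<gamma>: False
      show thesis
      proof (cases "\<gamma> = 1")
        case True
        show thesis
        proof (cases "\<alpha> = 0")
          case \<alpha>: True
          show thesis
            by (rule that[of 0 0 1 1 1 0]) (use \<beta> True \<alpha> in \<open>auto simp: P_params_def\<close>)
        next
          case False
          then obtain a where "a \<noteq> 0" "a ^ m = \<alpha>" using root by blast
          then show thesis
            by (intro that[of 1 0 1 a 1 0]) (use \<beta> True in \<open>auto simp: P_params_def\<close>)
        qed
      next
        case False
        \<comment> \<open>With \<open>\<beta>' = 0\<close> and \<open>\<gamma>' = 2\<close> the third equation reads \<open>(2 - t) * \<gamma> = 2\<close>.\<close>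
        define t where "t = 2 - 2 / \<gamma>"
        have t: "t \<noteq> 0" "(2 - t) * \<gamma> = 2" "2 - t \<noteq> 0"
          using \<gamma> False by (auto simp: t_def field_simps)
        have k: "t\<^sup>2 - 0 * (t - 1) - 2 * t * (t - 1) = t * (2 - t)"
          by (simp add: power2_eq_square algebra_simps)
        show thesis
        proof (cases "\<alpha> = 0")
          case True
          show thesis
            by (rule that[of 0 0 2 1 t 0], unfold k) (use \<beta> t True in \<open>auto simp: P_params_def\<close>)
        next
          case False
          then obtain a where "a \<noteq> 0" "a ^ m = (2 - t) * \<alpha>" using root[of "(2 - t) * \<alpha>"] t(3) by auto
          then show thesis
            by (intro that[of 1 0 2 a t 0], unfold k) (use \<beta> t in \<open>auto simp: P_params_def\<close>)
        qed
      qed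
    qed
  next
    case \<beta>: False
    show thesis
    proof (cases "\<gamma> = \<beta>")
      case \<gamma>: True
      show thesis
      proof (cases "\<beta> = 1")
        case True
        show thesis
          by (rule that[of 0 1 1 1 1 "- \<alpha>"]) (use \<gamma> True in \<open>auto simp: P_params_def\<close>)
      next
        case False
        \<comment> \<open>With \<open>\<beta>' = \<gamma>' = 2\<close> the second equation reads \<open>(2 - t\<^sup>2) * \<beta> = 2\<close>.\<close>
        define t where "t = csqrt (2 - 2 / \<beta>)"
        have t2: "t\<^sup>2 = 2 - 2 / \<beta>" by (simp add: t_def)
        have t: "t \<noteq> 0" using t2 \<beta> False by (auto simp: field_simps)
        have k: "t\<^sup>2 - 2 * (t - 1) - 2 * t * (t - 1) = 2 / \<beta>"
          using t2 by (simp add: power2_eq_square algebra_simps)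
        show thesis
          by (rule that[of 0 2 2 1 t "- \<alpha> / \<beta>"], unfold k)
            (use \<beta> \<gamma> t in \<open>auto simp: P_params_def\<close>)
      qed
    next
      case \<gamma>: False
      show thesis
      proof (cases "\<gamma> = 1")
        case True
        \<comment> \<open>With \<open>\<beta>' = 2\<close> and \<open>\<gamma>' = 1\<close> the second equation reads \<open>(2 - t) * \<beta> = 2\<close>.\<close>
        define t where "t = 2 - 2 / \<beta>"
        have t: "t \<noteq> 0" using \<beta> \<gamma> True by (auto simp: t_def field_simps)
        have k: "t\<^sup>2 - 2 * (t - 1) - 1 * t * (t - 1) = 2 / \<beta>"
          by (simp add: t_def power2_eq_square algebra_simps)
        show thesis
          by (rule that[of 0 2 1 1 t "- \<alpha> / \<beta>"], unfold k)
            (use \<beta> True t in \<open>auto simp: P_params_def t_def field_simps\<close>)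
      next
        case False
        \<comment> \<open>With \<open>\<beta>' = 1\<close> and \<open>h = (1 - \<gamma>') * t\<close> the equations read \<open>(1 + h * (t - 1)) * \<beta> = 1\<close>
          and \<open>(1 + h * (t - 1)) * \<gamma> = 1 - h\<close>; their quotient gives \<open>h\<close>, the first then \<open>t\<close>.\<close>
        define t where "t = (1 - \<gamma>) / (\<beta> - \<gamma>)"
        define h where "h = 1 - \<gamma> / \<beta>"
        have t: "t \<noteq> 0" and h: "h \<noteq> 0" using \<beta> \<gamma> False by (auto simp: t_def h_def field_simps)
        have ht: "h * t = (1 - \<gamma>) / \<beta>"
          using \<beta> \<gamma> by (simp add: t_def h_def field_simps)
        have "t\<^sup>2 - 1 * (t - 1) - (1 - h / t) * t * (t - 1) = 1 + h * t - h"
          using t by (simp add: power2_eq_square field_simps)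
        also have "\<dots> = 1 / \<beta>"
          using \<beta> unfolding ht by (simp add: h_def field_simps)
        finally have k: "t\<^sup>2 - 1 * (t - 1) - (1 - h / t) * t * (t - 1) = 1 / \<beta>" .
        have "(0, 1, 1 - h / t) \<in> P_params" using t h by (simp add: P_params_def)
        then show thesis
          by (rule that[of 0 1 "1 - h / t" 1 t "- \<alpha> / \<beta>"], unfold k)
            (use \<beta> t in \<open>auto simp: h_def field_simps\<close>)
      qed
    qed
  qed
qed

context filiform_extension
begin

text \<open>
  If the given relation has no \<open>w4\<close>-part, a change with \<open>a = 1\<close>, \<open>c = 0\<close> and \<open>b = t - 1\<close> creates one
  with coefficient \<open>(t - 1) (p1 t - p3)\<close>, up to a nonzero factor; since \<open>p1\<close> and \<open>p3\<close> are not both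
  zero, \<open>t = 2\<close> or \<open>t = 3\<close> makes it nonzero.
\<close>

lemma relation_with_w4:
  assumes xy: "adapted x y" and w2: "w2 x y \<noteq> 0"
  obtains x' y' \<alpha> \<beta> \<gamma> where "adapted x' y'"
    "w4 x' y' = \<alpha> *\<^sub>s w2 x' y' - \<beta> *\<^sub>s w1 x' y' + \<gamma> *\<^sub>s w3 x' y'"
proof -
  obtain p1 p2 p3 p4 where
    rel: "p1 *\<^sub>s w1 x y + p2 *\<^sub>s w2 x y + p3 *\<^sub>s w3 x y + p4 *\<^sub>s w4 x y = 0"
    and nz: "p1 \<noteq> 0 \<or> p2 \<noteq> 0 \<or> p3 \<noteq> 0 \<or> p4 \<noteq> 0"
    using adapted_relation[OF xy] by blast
  have solve: "w4 u v = (- (q2 / q4)) *\<^sub>s w2 u v - (q1 / q4) *\<^sub>s w1 u v + (- (q3 / q4)) *\<^sub>s w3 u v"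
    if r: "q1 *\<^sub>s w1 u v + q2 *\<^sub>s w2 u v + q3 *\<^sub>s w3 u v + q4 *\<^sub>s w4 u v = 0" and "q4 \<noteq> 0"
    for u v q1 q2 q3 q4
  proof -
    have "q4 *\<^sub>s w4 u v = - (q1 *\<^sub>s w1 u v + q2 *\<^sub>s w2 u v + q3 *\<^sub>s w3 u v)"
      using r by (metis add.commute eq_neg_iff_add_eq_0)
    then have "w4 u v = (1 / q4) *\<^sub>s (- (q1 *\<^sub>s w1 u v + q2 *\<^sub>s w2 u v + q3 *\<^sub>s w3 u v))"
      using \<open>q4 \<noteq> 0\<close> by (metis scale_scale scale_one nonzero_eq_divide_eq)
    also have "\<dots> = (- (q2 / q4)) *\<^sub>s w2 u v - (q1 / q4) *\<^sub>s w1 u v + (- (q3 / q4)) *\<^sub>s w3 u v"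
      by (simp add: scale_right_distrib scale_right_diff_distrib algebra_simps)
    finally show ?thesis .
  qed
  show thesis
  proof (cases "p4 = 0")
    case False
    then show thesis using that[OF xy] solve[OF rel] by blast
  next
    case True
    have p13: "p1 \<noteq> 0 \<or> p3 \<noteq> 0"
    proof (rule ccontr)
      assume "\<not> ?thesis"
      then have "p2 *\<^sub>s w2 x y = 0" "p2 \<noteq> 0" using rel nz True by auto
      then show False using w2 by simp
    qed
    obtain t :: complex where t: "t \<noteq> 0" "t \<noteq> 1" "p1 * t \<noteq> p3"
    proof (cases "p1 * 2 = p3")
      case True
      then have "p1 * 3 \<noteq> p3" using p13 by auto
      then show thesis using that[of 3] by simp
    next
      case False
      then show thesis using that[of 2] by simp
    qed
    define x' y' where "x' = 1 *\<^sub>s x + (t - 1) *\<^sub>s y + 0 *\<^sub>s rpow x (n - 2) y"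
      and "y' = (1 + (t - 1)) *\<^sub>s y"
    note change = adapted_change[OF xy, of 1 "t - 1" 0, folded x'_def y'_def]
    have x'y': "adapted x' y'" using change(1) t by simp
    have w: "w1 x' y' = w1 x y + (t - 1) *\<^sub>s (w3 x y - w4 x y)" "w2 x' y' = t *\<^sub>s w2 x y"
      "w3 x' y' = t *\<^sub>s (w3 x y + (t - 1) *\<^sub>s w4 x y)" "w4 x' y' = t\<^sup>2 *\<^sub>s w4 x y"
      using change(2-5) t by simp_all
    \<comment> \<open>The formulas for the new elements, inverted and multiplied by \<open>t\<^sup>2\<close> to clear denominators.\<close>
    have "t\<^sup>2 *\<^sub>s (p1 *\<^sub>s w1 x y + p2 *\<^sub>s w2 x y + p3 *\<^sub>s w3 x y) =
      (t\<^sup>2 * p1) *\<^sub>s w1 x' y' + (t * p2) *\<^sub>s w2 x' y' + (t * (p3 - p1 * (t - 1))) *\<^sub>s w3 x' y'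
        + ((t - 1) * (p1 * t - p3)) *\<^sub>s w4 x' y'"
      unfolding w by (simp add: algebra_simps power2_eq_square)
    moreover have "p1 *\<^sub>s w1 x y + p2 *\<^sub>s w2 x y + p3 *\<^sub>s w3 x y = 0" using rel True by simp
    ultimately have rel': "(t\<^sup>2 * p1) *\<^sub>s w1 x' y' + (t * p2) *\<^sub>s w2 x' y'
        + (t * (p3 - p1 * (t - 1))) *\<^sub>s w3 x' y' + ((t - 1) * (p1 * t - p3)) *\<^sub>s w4 x' y' = 0"
      by simp
    have "(t - 1) * (p1 * t - p3) \<noteq> 0" using t by simp
    then show thesis using that[OF x'y'] solve[OF rel'] by blast
  qed
qed

lemma adapted_classification:
  assumes xy: "adapted x y"
  shows "(\<exists>(\<alpha>, \<beta>, \<gamma>) \<in> P_params. A \<cong>\<^sub>a P n \<alpha> \<beta> \<gamma>) \<or> A \<cong>\<^sub>a Pstar n"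
proof (cases "w2 x y = 0")
  case True
  then show ?thesis using alg_isomorphic_Pstar[OF xy] by blast
next
  case False
  then obtain x\<^sub>0 y\<^sub>0 \<alpha> \<beta> \<gamma> where xy0: "adapted x\<^sub>0 y\<^sub>0"
    and rel: "w4 x\<^sub>0 y\<^sub>0 = \<alpha> *\<^sub>s w2 x\<^sub>0 y\<^sub>0 - \<beta> *\<^sub>s w1 x\<^sub>0 y\<^sub>0 + \<gamma> *\<^sub>s w3 x\<^sub>0 y\<^sub>0"
    using relation_with_w4[OF xy] by blast
  have m: "0 < n - 2" using n by simp
  obtain \<alpha>' \<beta>' \<gamma>' a t c where params: "(\<alpha>', \<beta>', \<gamma>') \<in> P_params" and at: "a \<noteq> 0" "t \<noteq> 0"
    and eqs: "(t\<^sup>2 - \<beta>' * (t - 1) - \<gamma>' * t * (t - 1)) * \<alpha> = \<alpha>' * t * a ^ (n - 2) - \<beta>' * c"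
    "(t\<^sup>2 - \<beta>' * (t - 1) - \<gamma>' * t * (t - 1)) * \<beta> = \<beta>'"
    "(t\<^sup>2 - \<beta>' * (t - 1) - \<gamma>' * t * (t - 1)) * \<gamma> = \<gamma>' * t - \<beta>' * (t - 1)"
    by (rule P_change_of_parameters[OF m])
  define k where "k = t\<^sup>2 - \<beta>' * (t - 1) - \<gamma>' * t * (t - 1)"
  define x' y' where "x' = a *\<^sub>s x\<^sub>0 + (a * (t - 1)) *\<^sub>s y\<^sub>0 + (a * c) *\<^sub>s rpow x\<^sub>0 (n - 2) y\<^sub>0"
    and "y' = (a + a * (t - 1)) *\<^sub>s y\<^sub>0"
  note change = adapted_change[OF xy0, of a "a * (t - 1)" "a * c", folded x'_def y'_def]
  have d: "a + a * (t - 1) = a * t" by (simp add: algebra_simps)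
  have x'y': "adapted x' y'" using change(1) at d by simp
  have "n - 1 = Suc (n - 2)" using n by linarith
  then have n1: "a ^ (n - 1) = a * a ^ (n - 2)" by simp
  let ?w1 = "w1 x\<^sub>0 y\<^sub>0" and ?w2 = "w2 x\<^sub>0 y\<^sub>0" and ?w3 = "w3 x\<^sub>0 y\<^sub>0" and ?w4 = "w4 x\<^sub>0 y\<^sub>0"
  have w: "w1 x' y' = a\<^sup>2 *\<^sub>s (?w1 + c *\<^sub>s ?w2 + (t - 1) *\<^sub>s ?w3 - (t - 1) *\<^sub>s ?w4)"
    "w2 x' y' = a\<^sup>2 *\<^sub>s (t * a ^ (n - 2)) *\<^sub>s ?w2"
    "w3 x' y' = a\<^sup>2 *\<^sub>s (t *\<^sub>s ?w3 + (t * (t - 1)) *\<^sub>s ?w4)"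
    "w4 x' y' = a\<^sup>2 *\<^sub>s t\<^sup>2 *\<^sub>s ?w4"
    using change(2-5) at unfolding d n1
    by (simp_all add: algebra_simps power2_eq_square)
  have "k *\<^sub>s ?w4 = (k * \<alpha>) *\<^sub>s ?w2 - (k * \<beta>) *\<^sub>s ?w1 + (k * \<gamma>) *\<^sub>s ?w3"
    unfolding rel by (simp add: scale_right_distrib scale_right_diff_distrib)
  also have "\<dots> = (\<alpha>' * t * a ^ (n - 2) - \<beta>' * c) *\<^sub>s ?w2 - \<beta>' *\<^sub>s ?w1
      + (\<gamma>' * t - \<beta>' * (t - 1)) *\<^sub>s ?w3"
    unfolding k_def eqs ..
  finally have t2w4: "t\<^sup>2 *\<^sub>s ?w4 = \<alpha>' *\<^sub>s (t * a ^ (n - 2)) *\<^sub>s ?w2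
      - \<beta>' *\<^sub>s (?w1 + c *\<^sub>s ?w2 + (t - 1) *\<^sub>s ?w3 - (t - 1) *\<^sub>s ?w4)
      + \<gamma>' *\<^sub>s (t *\<^sub>s ?w3 + (t * (t - 1)) *\<^sub>s ?w4)"
    unfolding k_def by (simp add: algebra_simps power2_eq_square)
  have pull: "a\<^sup>2 *\<^sub>s (\<alpha>' *\<^sub>s u - \<beta>' *\<^sub>s v + \<gamma>' *\<^sub>s z)
      = \<alpha>' *\<^sub>s a\<^sup>2 *\<^sub>s u - \<beta>' *\<^sub>s a\<^sup>2 *\<^sub>s v + \<gamma>' *\<^sub>s a\<^sup>2 *\<^sub>s z" for u v z
    by (simp add: scale_right_distrib scale_right_diff_distrib mult.commute)
  have "w4 x' y' = \<alpha>' *\<^sub>s w2 x' y' - \<beta>' *\<^sub>s w1 x' y' + \<gamma>' *\<^sub>s w3 x' y'"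
    unfolding w t2w4 by (rule pull)
  then have "A \<cong>\<^sub>a P n \<alpha>' \<beta>' \<gamma>'" by (rule alg_isomorphic_P[OF x'y'])
  then show ?thesis using params by blast
qed

end

lemma F1_bracket_basis:
  assumes "i \<in> {1..n}" "j \<in> {1..n}"
  shows "bracket (F1 n) (e i) (e j) =
    (if i = 1 \<and> j = 1 then e 3 else if 2 \<le> i \<and> i \<le> n - 1 \<and> j = 1 then e (i + 1) else 0)"
  unfolding F1_def by (rule table_alg_bracket_basis) (use assms in auto)

text \<open>
  It remains to see that lifts of \<open>e 1\<close> and \<open>e 2\<close> form an adapted pair and that the
  algebra has dimension at least \<open>n + 3\<close>. For the latter, a basis of the kernel is extended to
  a basis of the algebra; the images of the added vectors span \<open>F1 n\<close>.
\<close>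

theorem non_split_extension_classification:
  fixes E :: "'a::ab_group_add calg"
  assumes n: "3 \<le> n" and ns: "non_split_extension 3 E (F1 n)"
  shows "(\<exists>(\<alpha>, \<beta>, \<gamma>) \<in> P_params. E \<cong>\<^sub>a P n \<alpha> \<beta> \<gamma>) \<or> E \<cong>\<^sub>a Pstar n"
proof -
  obtain \<pi> where lE: "leibniz_algebra E" and \<pi>: "alg_hom E (F1 n) \<pi>" "\<pi> ` carr E = carr (F1 n)"
    and ker: "{x \<in> carr E. \<pi> x = 0} \<subseteq> alg_center E"
    "vector_space.dim (smul E) {x \<in> carr E. \<pi> x = 0} = 3"
    "{x \<in> carr E. \<pi> x = 0} \<subseteq> leibniz_algebra.derived E"
    by (rule non_split_extension_kernel[OF ns]) simp_all
  interpret E: leibniz_algebra E by fact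
  define K where "K = {x \<in> carr E. \<pi> x = 0}"
  have F1_carr: "carr (F1 n) = cscale.span (e ` {1..n})"
    unfolding F1_def by (rule table_alg_span[symmetric])
  have \<pi>_scale: "\<pi> (smul E c u) = cscale c (\<pi> u)" if "u \<in> carr E" for c u
    using \<pi>(1) that by (simp add: alg_hom_def F1_def)
  have \<pi>_add: "\<pi> (u + v) = \<pi> u + \<pi> v"
    and \<pi>_bracket: "\<pi> (bracket E u v) = bracket (F1 n) (\<pi> u) (\<pi> v)"
    if "u \<in> carr E" "v \<in> carr E" for u v
    using \<pi>(1) that by (simp_all add: alg_hom_def)
  have \<pi>0: "\<pi> 0 = 0" using \<pi>_scale[of 0 0] by simp
  have \<pi>_diff: "\<pi> (u - v) = \<pi> u - \<pi> v" if "u \<in> carr E" "v \<in> carr E" for u v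
    using \<pi>_add[of "u - v" v] that by (simp add: algebra_simps)
  have \<pi>_sum: "\<pi> (\<Sum>i\<in>I. f i) = (\<Sum>i\<in>I. \<pi> (f i))" if "\<And>i. i \<in> I \<Longrightarrow> f i \<in> carr E"
    for f :: "nat \<Rightarrow> 'a" and I
    using that by (induction I rule: infinite_finite_induct) (simp_all add: \<pi>0 \<pi>_add)
  have subK: "E.subspace K" "K \<subseteq> carr E"
    unfolding K_def by (auto intro!: E.subspaceI simp: \<pi>_add \<pi>_scale \<pi>0)
  have dim: "n + 3 \<le> E.dim (carr E)"
  proof -
    obtain C where C: "finite C" "C \<subseteq> K" "E.independent C" "E.span C = K" "card C = E.dim K"
      by (rule E.finite_basis_of_subspace[OF subK])
    obtain B where B: "C \<subseteq> B" "B \<subseteq> carr E" "E.independent B" "carr E \<subseteq> E.span B"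
      by (rule E.maximal_independent_subset_extend[OF subset_trans[OF C(2) subK(2)] C(3)])
    obtain F where F: "finite F" "E.span F = carr E" using E.finite_dimensional by blast
    then have finB: "finite B"
      using E.independent_span_bound[OF F(1) B(3)] B(2) by simp
    have "carr E \<subseteq> {u \<in> carr E. \<pi> u \<in> cscale.span (\<pi> ` (B - C))}"
    proof -
      have "E.subspace {u \<in> carr E. \<pi> u \<in> cscale.span (\<pi> ` (B - C))}"
        by (rule E.subspaceI)
          (auto simp: \<pi>_add \<pi>_scale \<pi>0 cscale.span_add cscale.span_scale cscale.span_zero)
      moreover have "B \<subseteq> {u \<in> carr E. \<pi> u \<in> cscale.span (\<pi> ` (B - C))}"
      proof
        fix u assume u: "u \<in> B"
        have "\<pi> u \<in> cscale.span (\<pi> ` (B - C))"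
        proof (cases "u \<in> C")
          case True
          then have "\<pi> u = 0" using C(2) by (auto simp: K_def)
          then show ?thesis by (simp add: cscale.span_zero)
        next
          case False
          then show ?thesis using u by (intro cscale.span_base) blast
        qed
        then show "u \<in> {u \<in> carr E. \<pi> u \<in> cscale.span (\<pi> ` (B - C))}" using u B(2) by blast
      qed
      ultimately have "E.span B \<subseteq> {u \<in> carr E. \<pi> u \<in> cscale.span (\<pi> ` (B - C))}"
        by (intro E.span_minimal)
      then show ?thesis using B(4) by (rule subset_trans[rotated])
    qed
    then have "carr (F1 n) \<subseteq> cscale.span (\<pi> ` (B - C))"
      unfolding \<pi>(2)[symmetric] by (intro image_subsetI) (drule (1) subsetD, simp)
    then have "e ` {1..n} \<subseteq> cscale.span (\<pi> ` (B - C))"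
      unfolding F1_carr by (rule subset_trans[OF cscale.span_superset])
    moreover have "finite (\<pi> ` (B - C))" using finB by simp
    ultimately have "card (e ` {1..n}) \<le> card (\<pi> ` (B - C))"
      using cscale.independent_span_bound[OF _ independent_e(2)] by (metis (no_types))
    also have "\<dots> \<le> card (B - C)" using finB by (intro card_image_le finite_Diff)
    finally have "n \<le> card (B - C)" using independent_e(1)[of n] by (simp add: card_image)
    moreover have "card (B - C) = card B - 3"
      using card_Diff_subset[OF C(1) B(1)] C(5) ker(2) by (simp add: K_def)
    moreover have "3 \<le> card B"
      using card_mono[OF finB B(1)] C(5) ker(2) by (simp add: K_def)
    ultimately have "n + 3 \<le> card B" by linarith
    also have "card B = E.dim (carr E)" using B(2-4) by (intro E.basis_card_eq_dim)
    finally show ?thesis .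
  qed
  interpret filiform_extension E K n
    by unfold_locales (use n subK ker dim in \<open>simp_all add: K_def\<close>)
  have e_F1: "e i \<in> \<pi> ` carr E" if "i \<in> {1..n}" for i
    unfolding \<pi>(2) F1_def using that by (rule e_in_table_alg)
  obtain x where x: "x \<in> carr E" "\<pi> x = e 1" using e_F1[of 1] n by auto
  obtain y where y: "y \<in> carr E" "\<pi> y = e 2" using e_F1[of 2] n by auto
  have chain: "\<pi> (rpow x k y) = e (k + 2)" if "k < n - 1" for k
    using that
  proof (induction k)
    case 0
    show ?case using y by (simp add: numeral_2_eq_2)
  next
    case (Suc k)
    then show ?case using x y n by (simp add: \<pi>_bracket F1_bracket_basis)
  qed
  have chain_end: "\<pi> (rpow x (n - 1) y) = 0"
  proof -
    have "n - 1 = Suc (n - 2)" "n - 2 + 2 = n" using n by linarith+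
    then show ?thesis using chain[of "n - 2"] x y n by (simp add: \<pi>_bracket F1_bracket_basis)
  qed
  have "adapted x y"
    unfolding adapted_def
  proof (intro conjI)
    show "x \<in> carr E" "y \<in> carr E" by fact+
    have K_I: "u \<in> K" if "u \<in> carr E" "\<pi> u = 0" for u
      using that unfolding K_def by blast
    have 12: "1 \<in> {1..n}" "2 \<in> {1..n}" using n by simp_all
    note F1_12 = F1_bracket_basis[OF 12(1) 12(1)] F1_bracket_basis[OF 12(1) 12(2)]
      F1_bracket_basis[OF 12(2) 12(1)] F1_bracket_basis[OF 12(2) 12(2)]
    have "(2::nat) \<le> n - 1" using n by linarith
    then have xx_yx: "\<pi> (bracket E x x) = e 3" "\<pi> (bracket E y x) = e 3"
      "\<pi> (bracket E x y) = 0" "\<pi> (bracket E y y) = 0"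
      unfolding \<pi>_bracket[OF x(1) x(1)] \<pi>_bracket[OF y(1) x(1)] \<pi>_bracket[OF x(1) y(1)]
        \<pi>_bracket[OF y(1) y(1)] x(2) y(2) F1_12 by simp_all
    show "w1 x y \<in> K"
      unfolding w1_def using x(1) y(1) xx_yx by (intro K_I) (simp_all add: \<pi>_diff)
    show "w3 x y \<in> K" "w4 x y \<in> K"
      unfolding w3_def w4_def using x(1) y(1) xx_yx by (simp_all add: K_I)
    show "w2 x y \<in> K"
      unfolding w2_def using x(1) y(1) chain_end by (intro K_I) simp_all
    show "carr E \<subseteq> E.span (insert x ((\<lambda>k. rpow x k y) ` {..<n - 1}) \<union> K)"
    proof
      fix u assume u: "u \<in> carr E"
      define g where "g i = (if i = 1 then x else rpow x (i - 2) y)" for i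
      let ?v = "\<Sum>i=1..n. smul E (\<pi> u i) (g i)"
      let ?S = "E.span (insert x ((\<lambda>k. rpow x k y) ` {..<n - 1}) \<union> K)"
      have f: "g i \<in> carr E" for i using x y by (simp add: g_def)
      have \<pi>f: "\<pi> (g i) = e i" if "i \<in> {1..n}" for i
      proof (cases "i = 1")
        case True
        then show ?thesis using x(2) by (simp add: g_def)
      next
        case False
        then have "i - 2 < n - 1" "i - 2 + 2 = i" using that by auto
        then show ?thesis using chain[of "i - 2"] False by (simp only: g_def if_False)
      qed
      have "\<pi> u \<in> carr (F1 n)" using u \<pi>(2) by blast
      then have "\<pi> u = (\<Sum>i=1..n. cscale (\<pi> u i) (e i))"
        unfolding F1_def by (rule table_alg_expand)
      also have "\<dots> = (\<Sum>i=1..n. \<pi> (smul E (\<pi> u i) (g i)))"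
        using \<pi>f by (intro sum.cong) (simp_all add: \<pi>_scale[OF f])
      also have "\<dots> = \<pi> ?v"
        using f by (intro \<pi>_sum[symmetric]) simp
      finally have eq: "\<pi> u = \<pi> ?v" .
      have v: "?v \<in> carr E" using f by (intro E.carr_sum E.carr_closed)
      have "\<pi> (u - ?v) = \<pi> u - \<pi> ?v" by (rule \<pi>_diff[OF u v])
      also have "\<dots> = 0" unfolding right_minus_eq by (rule eq)
      finally have "u - ?v \<in> K" by (rule K_I[OF E.carr_closed(3)[OF u v]])
      then have "u - ?v \<in> ?S" by (intro E.span_base) simp
      moreover have "?v \<in> ?S"
      proof (intro E.span_sum E.span_scale E.span_base)
        fix i assume "i \<in> {1..n}"
        then show "g i \<in> insert x ((\<lambda>k. rpow x k y) ` {..<n - 1}) \<union> K"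
          using n by (auto simp: g_def)
      qed
      ultimately have "u - ?v + ?v \<in> ?S" by (rule E.span_add)
      then show "u \<in> ?S" by simp
    qed
  qed
  then show ?thesis by (rule adapted_classification)
qed

section \<open>Brackets in coordinates\<close>

lemma sum_supported_on_two:
  fixes f :: "nat \<Rightarrow> complex"
  assumes "finite I" "p \<in> I" "q \<in> I" "p \<noteq> q" "\<And>j. j \<in> I \<Longrightarrow> j \<noteq> p \<Longrightarrow> j \<noteq> q \<Longrightarrow> f j = 0"
  shows "sum f I = f p + f q"
proof -
  have "sum f I = sum f {p, q}"
    using assms by (intro sum.mono_neutral_right) auto
  then show ?thesis using assms(4) by simp
qed

lemma P_bracket_apply:
  assumes n: "3 \<le> n"
  shows "bracket (P n \<alpha> \<beta> \<gamma>) x y k =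
    (if k = 2 then (x 1 + x (n + 1)) * y 1
     else if 3 \<le> k \<and> k \<le> n then x (k - 1) * y 1 + (if k = n then \<alpha> * x (n + 1) * y (n + 1) else 0)
     else if k = n + 2 then x (n + 1) * y 1 + \<beta> * x (n + 1) * y (n + 1)
     else if k = n + 3 then x 1 * y (n + 1) + \<gamma> * x (n + 1) * y (n + 1)
     else 0)"
proof -
  define T :: "nat \<Rightarrow> nat \<Rightarrow> nat \<Rightarrow> complex" where "T = (\<lambda>i j.
    if 1 \<le> i \<and> i \<le> n - 1 \<and> j = 1 then e (i + 1)
    else if i = n + 1 \<and> j = 1 then e 2 + e (n + 2)
    else if i = 1 \<and> j = n + 1 then e (n + 3)
    else if i = n + 1 \<and> j = n + 1 then
      cscale \<alpha> (e n) + cscale \<beta> (e (n + 2)) + cscale \<gamma> (e (n + 3))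
    else 0)"
  have "bracket (P n \<alpha> \<beta> \<gamma>) x y k = (\<Sum>i=1..n+3. \<Sum>j=1..n+3. x i * y j * T i j k)"
    unfolding P_def T_def[symmetric] by (simp only: table_alg_simps sum_fun_apply cscale_apply)
  also have "\<dots> = (\<Sum>i=1..n+3. x i * y 1 * T i 1 k + x i * y (n + 1) * T i (n + 1) k)"
    using n by (intro sum.cong refl sum_supported_on_two) (auto simp: T_def)
  also have "\<dots> = (\<Sum>i=1..n+3. x i * y 1 * T i 1 k) + (\<Sum>i=1..n+3. x i * y (n + 1) * T i (n + 1) k)"
    by (rule sum.distrib)
  also have "(\<Sum>i=1..n+3. x i * y (n + 1) * T i (n + 1) k)
      = x 1 * y (n + 1) * T 1 (n + 1) k + x (n + 1) * y (n + 1) * T (n + 1) (n + 1) k"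
    by (intro sum_supported_on_two) (use n in \<open>auto simp: T_def\<close>)
  also have "(\<Sum>i=1..n+3. x i * y 1 * T i 1 k)
      = (if 2 \<le> k \<and> k \<le> n then x (k - 1) * y 1 else 0) + x (n + 1) * y 1 * T (n + 1) 1 k"
  proof -
    have "(\<Sum>i=1..n+3. x i * y 1 * T i 1 k)
        = (\<Sum>i=1..n+3. (if i = k - 1 \<and> 2 \<le> k \<and> k \<le> n then x (k - 1) * y 1 else 0)
            + (if i = n + 1 then x (n + 1) * y 1 * T (n + 1) 1 k else 0))"
      using n by (intro sum.cong) (auto simp: T_def e_def)
    also have "\<dots> = (\<Sum>i=1..n+3. if i = k - 1 then if 2 \<le> k \<and> k \<le> n then x (k - 1) * y 1 else 0 else 0)
            + x (n + 1) * y 1 * T (n + 1) 1 k"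
      unfolding sum.distrib by (intro arg_cong2[where f = "(+)"] sum.cong) auto
    finally show ?thesis by auto
  qed
  finally show ?thesis
    using n by (cases "k = 2") (auto simp: T_def e_def cscale_apply algebra_simps)
qed

lemma Pstar_bracket_apply:
  assumes n: "3 \<le> n"
  shows "bracket (Pstar n) x y k =
    (if k = 2 then (x 1 + x n) * y 1
     else if 3 \<le> k \<and> k \<le> n - 1 then x (k - 1) * y 1
     else if k = n + 1 then x n * y 1
     else if k = n + 2 then x 1 * y n
     else if k = n + 3 then x n * y n
     else 0)"
proof -
  define T :: "nat \<Rightarrow> nat \<Rightarrow> nat \<Rightarrow> complex" where "T = (\<lambda>i j.
    if 1 \<le> i \<and> i \<le> n - 2 \<and> j = 1 then e (i + 1)
    else if i = n \<and> j = 1 then e 2 + e (n + 1)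
    else if i = 1 \<and> j = n then e (n + 2)
    else if i = n \<and> j = n then e (n + 3)
    else 0)"
  have "bracket (Pstar n) x y k = (\<Sum>i=1..n+3. \<Sum>j=1..n+3. x i * y j * T i j k)"
    unfolding Pstar_def T_def[symmetric] by (simp only: table_alg_simps sum_fun_apply cscale_apply)
  also have "\<dots> = (\<Sum>i=1..n+3. x i * y 1 * T i 1 k + x i * y n * T i n k)"
    using n by (intro sum.cong refl sum_supported_on_two) (auto simp: T_def)
  also have "\<dots> = (\<Sum>i=1..n+3. x i * y 1 * T i 1 k) + (\<Sum>i=1..n+3. x i * y n * T i n k)"
    by (rule sum.distrib)
  also have "(\<Sum>i=1..n+3. x i * y n * T i n k) = x 1 * y n * T 1 n k + x n * y n * T n n k"
    by (intro sum_supported_on_two) (use n in \<open>auto simp: T_def\<close>)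
  also have "(\<Sum>i=1..n+3. x i * y 1 * T i 1 k)
      = (if 2 \<le> k \<and> k \<le> n - 1 then x (k - 1) * y 1 else 0) + x n * y 1 * T n 1 k"
  proof -
    have "(\<Sum>i=1..n+3. x i * y 1 * T i 1 k)
        = (\<Sum>i=1..n+3. (if i = k - 1 \<and> 2 \<le> k \<and> k \<le> n - 1 then x (k - 1) * y 1 else 0)
            + (if i = n then x n * y 1 * T n 1 k else 0))"
      using n by (intro sum.cong) (auto simp: T_def e_def)
    also have "\<dots> = (\<Sum>i=1..n+3. if i = k - 1 then if 2 \<le> k \<and> k \<le> n - 1 then x (k - 1) * y 1 else 0 else 0)
            + x n * y 1 * T n 1 k"
      unfolding sum.distrib using n by (intro arg_cong2[where f = "(+)"] sum.cong) auto
    finally show ?thesis by auto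
  qed
  finally show ?thesis
    using n by (cases "k = 2") (auto simp: T_def e_def cscale_apply algebra_simps)
qed

section \<open>The algebras of the list are pairwise non-isomorphic\<close>

lemma P_bracket_basis:
  assumes "i \<in> {1..n + 3}" "j \<in> {1..n + 3}"
  shows "bracket (P n \<alpha> \<beta> \<gamma>) (e i) (e j) =
    (if i < n \<and> j = 1 then e (i + 1)
     else if i = n + 1 \<and> j = 1 then e 2 + e (n + 2)
     else if i = 1 \<and> j = n + 1 then e (n + 3)
     else if i = n + 1 \<and> j = n + 1 then
       cscale \<alpha> (e n) + cscale \<beta> (e (n + 2)) + cscale \<gamma> (e (n + 3))
     else 0)"
proof -
  have "1 \<le> i \<and> i \<le> n - 1 \<and> j = 1 \<longleftrightarrow> i < n \<and> j = 1"
    using assms by auto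
  then show ?thesis
    unfolding P_def by (simp only: table_alg_bracket_basis[OF assms])
qed

lemma P_simps:
  "smul (P n \<alpha> \<beta> \<gamma>) = cscale"
  "v \<in> carr (P n \<alpha> \<beta> \<gamma>) \<longleftrightarrow> (\<forall>k. k \<notin> {1..n + 3} \<longrightarrow> v k = 0)"
  by (simp_all add: P_def del: atLeastAtMost_iff)

lemma e_neq_0: "e i \<noteq> 0"
  by (auto simp: e_def fun_eq_iff)

lemma e_in_P: "i \<in> {1..n + 3} \<Longrightarrow> e i \<in> carr (P n \<alpha> \<beta> \<gamma>)"
  unfolding P_def by (rule e_in_table_alg)

text \<open>
  For both questions of isomorphism the source is \<open>P n \<alpha> \<beta> \<gamma>\<close>, and everything is
  expressed through the images \<open>u\<close>, \<open>v\<close> of its two generators \<open>e 1\<close> and \<open>e (n + 1)\<close>.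
\<close>

locale P_injective_hom =
  fixes n :: nat and \<alpha> \<beta> \<gamma> :: complex and B :: "(nat \<Rightarrow> complex) calg" and f
  assumes n: "3 \<le> n" and hom: "alg_hom (P n \<alpha> \<beta> \<gamma>) B f"
    and inj: "inj_on f (carr (P n \<alpha> \<beta> \<gamma>))" and smul_B: "smul B = cscale"
begin

abbreviation u where "u \<equiv> f (e 1)"
abbreviation v where "v \<equiv> f (e (n + 1))"

lemma
  assumes "x \<in> carr (P n \<alpha> \<beta> \<gamma>)" "y \<in> carr (P n \<alpha> \<beta> \<gamma>)"
  shows f_add: "f (x + y) = f x + f y"
    and f_scale: "f (cscale c x) = cscale c (f x)"
    and f_bracket: "f (bracket (P n \<alpha> \<beta> \<gamma>) x y) = bracket B (f x) (f y)"
  using hom assms smul_B by (auto simp: alg_hom_def P_simps(1))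

lemma f_0: "f 0 = 0"
  using f_scale[of 0 0 0] by (simp add: P_simps)

lemma f_e_neq_0: "i \<in> {1..n + 3} \<Longrightarrow> f (e i) \<noteq> 0"
  using inj_onD[OF inj, of "e i" 0] e_in_P e_neq_0 f_0 by (fastforce simp: P_simps)

lemma f_e_bracket:
  assumes "i \<in> {1..n + 3}" "j \<in> {1..n + 3}"
  shows "bracket B (f (e i)) (f (e j)) = f (bracket (P n \<alpha> \<beta> \<gamma>) (e i) (e j))"
  using f_bracket e_in_P assms by metis

lemma f_chain: "1 \<le> i \<Longrightarrow> i < n \<Longrightarrow> bracket B (f (e i)) u = f (e (Suc i))"
  by (simp add: f_e_bracket P_bracket_basis)

lemma uv: "bracket B u v = f (e (n + 3))"
  using n by (simp add: f_e_bracket P_bracket_basis)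

lemma vu: "bracket B v u = f (e 2) + f (e (n + 2))"
  using n f_add[OF e_in_P e_in_P, of 2 "n + 2"] by (simp add: f_e_bracket P_bracket_basis)

lemma e2v: "bracket B (f (e 2)) v = 0"
  using n by (simp add: f_e_bracket P_bracket_basis f_0)

lemma e_n2_u: "bracket B (f (e (n + 2))) u = 0"
  using n by (simp add: f_e_bracket P_bracket_basis f_0)

lemma vv: "bracket B v v = cscale \<alpha> (f (e n)) + cscale \<beta> (f (e (n + 2))) + cscale \<gamma> (f (e (n + 3)))"
proof -
  have "cscale c (e i) \<in> carr (P n \<alpha> \<beta> \<gamma>)" if "i \<in> {1..n + 3}" for c i
    using e_in_P[OF that] by (simp add: P_simps cscale_apply)
  moreover have "cscale \<alpha> (e n) + cscale \<beta> (e (n + 2)) \<in> carr (P n \<alpha> \<beta> \<gamma>)"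
    using n by (auto simp: P_simps cscale_apply e_def)
  ultimately show ?thesis
    using n by (simp add: f_e_bracket P_bracket_basis f_add f_scale e_in_P)
qed

end

text \<open>
  In \<open>Pstar n\<close>, multiplication by any element shifts the coordinates \<open>2, \<dots>, n - 1\<close> of a
  product upwards by one place, so nothing is left of the image of \<open>e n\<close>, a left-normed product of
  \<open>n\<close> factors \<open>u\<close>.
\<close>

lemma P_not_isomorphic_Pstar:
  assumes n: "3 \<le> n"
  shows "\<not> P n \<alpha> \<beta> \<gamma> \<cong>\<^sub>a Pstar n"
proof
  assume "P n \<alpha> \<beta> \<gamma> \<cong>\<^sub>a Pstar n"
  then obtain f where f: "alg_hom (P n \<alpha> \<beta> \<gamma>) (Pstar n) f"
      "bij_betw f (carr (P n \<alpha> \<beta> \<gamma>)) (carr (Pstar n))"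
    unfolding alg_isomorphic_def by blast
  have "smul (Pstar n) = cscale" by (simp add: Pstar_def)
  then interpret P_injective_hom n \<alpha> \<beta> \<gamma> "Pstar n" f
    using n f(1) bij_betw_imp_inj_on[OF f(2)] by (intro P_injective_hom.intro)
  have shift: "bracket (Pstar n) z w j = (if 3 \<le> j \<and> j < n then z (j - 1) * w 1 else 0)"
    if "z 1 = 0" "z n = 0" for z w j
  proof -
    have "3 \<le> j \<and> j \<le> n - 1 \<longleftrightarrow> 3 \<le> j \<and> j < n" using n by linarith
    then show ?thesis using that by (simp only: Pstar_bracket_apply[OF n]) simp
  qed
  have e2: "f (e 2) = bracket (Pstar n) u u"
    using f_chain[of 1] n by (simp add: numeral_2_eq_2)
  have e2_0: "f (e 2) 1 = 0" "f (e 2) n = 0"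
  proof -
    have "\<not> n \<le> n - 1" using n by linarith
    then show "f (e 2) 1 = 0" "f (e 2) n = 0"
      using n by (simp_all add: e2 Pstar_bracket_apply[OF n])
  qed
  have chain: "\<forall>j. j < k \<or> n \<le> j \<longrightarrow> f (e k) j = 0" if "3 \<le> k" "k \<le> n" for k
    using that
  proof (induction k rule: dec_induct)
    case base
    have "f (e 3) = bracket (Pstar n) (f (e 2)) u"
      using f_chain[of 2] n by (simp add: numeral_2_eq_2 numeral_3_eq_3)
    then show ?case by (simp add: shift[OF e2_0])
  next
    case (step k)
    have "f (e k) 1 = 0" "f (e k) n = 0" using step by simp_all
    moreover have "f (e (Suc k)) = bracket (Pstar n) (f (e k)) u"
      using f_chain[of k] step by simp
    ultimately have "f (e (Suc k)) j = (if 3 \<le> j \<and> j < n then f (e k) (j - 1) * u 1 else 0)" for j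
      by (simp only: shift)
    moreover have "j - 1 < k" if "j < Suc k" "3 \<le> j" for j using that by linarith
    ultimately show ?case using step.IH step.prems by auto
  qed
  have "f (e n) = 0"
    using chain[of n] n by (intro ext) (simp add: linorder_not_less[symmetric])
  then show False using f_e_neq_0[of n] n by simp
qed

text \<open>
  The generators keep their shape. The image of \<open>e (n + 1)\<close> annihilates the image of \<open>e 2\<close> from the
  right, which kills its coordinate at \<open>e 1\<close>; and the image of \<open>e (n + 2) = [y,x] - [x,x]\<close> is annihilated by \<open>u\<close>,
  which gives \<open>d = a + b\<close> for the leading coefficients. The three equations are the coordinates of
  \<open>[v,v]\<close> at \<open>n\<close>, \<open>n + 2\<close> and \<open>n + 3\<close>.
\<close>

lemma P_isomorphic_params:
  assumes n: "3 \<le> n" and iso: "P n \<alpha> \<beta> \<gamma> \<cong>\<^sub>a P n \<alpha>' \<beta>' \<gamma>'"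
  obtains a t k c where "a \<noteq> 0" "t \<noteq> 0" "k = t\<^sup>2 - \<beta> * (t - 1) - \<gamma> * t * (t - 1)"
    "k * \<alpha>' = \<alpha> * t * a ^ (n - 2) - \<beta> * c" "k * \<beta>' = \<beta>" "k * \<gamma>' = \<gamma> * t - \<beta> * (t - 1)"
proof -
  let ?B = "P n \<alpha>' \<beta>' \<gamma>'"
  from iso obtain f where f: "alg_hom (P n \<alpha> \<beta> \<gamma>) ?B f"
      "bij_betw f (carr (P n \<alpha> \<beta> \<gamma>)) (carr ?B)"
    unfolding alg_isomorphic_def by blast
  interpret P_injective_hom n \<alpha> \<beta> \<gamma> ?B f
    using n f(1) bij_betw_imp_inj_on[OF f(2)] P_simps(1) by (intro P_injective_hom.intro)
  note [simp del] = One_nat_def add_2_eq_Suc'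
  define a b d where "a = u 1" and "b = u (n + 1)" and "d = v (n + 1)"
  note br = P_bracket_apply[OF n, of \<alpha>' \<beta>' \<gamma>']
  have e2: "f (e 2) = bracket ?B u u" and e3: "f (e 3) = bracket ?B (f (e 2)) u"
    using f_chain[of 1] f_chain[of 2] n by (simp_all add: numeral_2_eq_2 numeral_3_eq_3)
  have e2_0: "f (e 2) 1 = 0" "f (e 2) (n + 1) = 0"
    using n by (simp_all add: e2 br)
  have bracket_e2: "bracket ?B (f (e 2)) w j = (if 3 \<le> j \<and> j \<le> n then f (e 2) (j - 1) * w 1 else 0)" for w j
    using e2_0 by (simp add: br)
  have "f (e 3) \<noteq> 0" using f_e_neq_0[of 3] n by simp
  then obtain j where "f (e 3) j \<noteq> 0" by (auto simp: fun_eq_iff)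
  then have j: "3 \<le> j" "j \<le> n" "f (e 2) (j - 1) \<noteq> 0" and a: "a \<noteq> 0"
    by (auto simp: e3 bracket_e2 a_def split: if_splits)
  have v1: "v 1 = 0"
    using fun_cong[OF e2v, of j] j by (simp add: bracket_e2)
  have e_n3: "f (e (n + 3)) k = (if k = n then \<alpha>' * b * d else if k = n + 2 then \<beta>' * b * d
      else if k = n + 3 then a * d + \<gamma>' * b * d else 0)" for k
    using n by (auto simp: uv[symmetric] br v1 a_def b_def d_def)
  have d: "d \<noteq> 0"
  proof
    assume "d = 0"
    then have "f (e (n + 3)) = 0" by (auto simp: e_n3)
    then show False using f_e_neq_0[of "n + 3"] by simp
  qed
  have e_n2: "f (e (n + 2)) k = bracket ?B v u k - bracket ?B u u k" for k
    using fun_cong[OF vu, of k] by (simp add: e2)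
  have "f (e (n + 2)) (n + 1) = 0"
    using n by (simp add: e_n2 br)
  then have "f (e (n + 2)) 2 = 0"
    using fun_cong[OF e_n2_u, of 3] n a by (simp add: br a_def split: if_splits)
  moreover have "f (e (n + 2)) 2 = d * a - (a + b) * a"
    using n by (simp add: e_n2 br v1 a_def b_def d_def)
  ultimately have "(d - (a + b)) * a = 0" by (simp add: left_diff_distrib)
  then have dab: "d = a + b" using a by simp
  have e2_2: "f (e 2) 2 = d * a"
    by (simp add: e2 br dab a_def b_def)
  have chain: "\<forall>j. j \<le> i \<or> n < j \<longrightarrow> f (e i) j = (if j = i then a ^ (i - 1) * d else 0)"
    if "3 \<le> i" "i \<le> n" for i
    using that
  proof (induction i rule: dec_induct)
    case base
    have "f (e 3) j = (if 3 \<le> j \<and> j \<le> n then f (e 2) (j - 1) * a else 0)" for j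
      by (simp only: e3 bracket_e2 a_def)
    then show ?case using n e2_2 by (simp add: power2_eq_square)
  next
    case (step i)
    have z: "f (e i) 1 = 0" "f (e i) (n + 1) = 0" using step by simp_all
    have e_Suc: "f (e (Suc i)) j = (if 3 \<le> j \<and> j \<le> n then f (e i) (j - 1) * a else 0)" for j
      using f_chain[of i, symmetric] step.hyps step.prems z by (simp add: br a_def)
    show ?case
    proof (intro allI impI)
      fix j assume j: "j \<le> Suc i \<or> n < j"
      show "f (e (Suc i)) j = (if j = Suc i then a ^ (Suc i - 1) * d else 0)"
      proof (cases "j = Suc i")
        case True
        have "f (e i) i = a ^ (i - 1) * d" using step by simp
        moreover have "a ^ i = a * a ^ (i - 1)" using step.hyps by (cases i) simp_all
        ultimately show ?thesis using True step.hyps step.prems by (simp add: e_Suc)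
      next
        case False
        show ?thesis
        proof (cases "3 \<le> j \<and> j \<le> n")
          case True
          then have "j - 1 \<le> i" "j - 1 \<noteq> i" using j False by linarith+
          then have "f (e i) (j - 1) = 0" using step by simp
          then show ?thesis using False by (simp add: e_Suc)
        next
          case outside: False
          then show ?thesis using False by (simp only: e_Suc if_False)
        qed
      qed
    qed
  qed
  have e_n: "f (e n) n = a ^ (n - 1) * d" "f (e n) (n + 2) = 0" "f (e n) (n + 3) = 0"
    using chain[of n] n by auto
  have vv': "bracket ?B v v k = \<alpha> * f (e n) k + \<beta> * f (e (n + 2)) k + \<gamma> * f (e (n + 3)) k" for k
    unfolding vv by (simp add: cscale_apply)
  have brvv: "bracket ?B v v n = \<alpha>' * d * d" "bracket ?B v v (n + 2) = \<beta>' * d * d"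
    "bracket ?B v v (n + 3) = \<gamma>' * d * d"
    using n by (simp_all add: br v1 d_def)
  have e_n2': "f (e (n + 2)) n = v (n - 1) * a + \<alpha>' * d * b - (u (n - 1) * a + \<alpha>' * b * b)"
    "f (e (n + 2)) (n + 2) = d * a + \<beta>' * d * b - (b * a + \<beta>' * b * b)"
    "f (e (n + 2)) (n + 3) = \<gamma>' * d * b - (a * b + \<gamma>' * b * b)"
    using n by (simp_all add: e_n2 br v1 a_def b_def d_def)
  have e_n3': "f (e (n + 3)) n = \<alpha>' * b * d" "f (e (n + 3)) (n + 2) = \<beta>' * b * d"
    "f (e (n + 3)) (n + 3) = a * d + \<gamma>' * b * d"
    by (simp_all add: e_n3)
  have \<beta>_eq: "\<beta>' * d * d = \<beta> * (d * a + \<beta>' * d * b - (b * a + \<beta>' * b * b)) + \<gamma> * (\<beta>' * b * d)"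
    using vv'[of "n + 2"] unfolding brvv e_n e_n2' e_n3' by simp
  have \<gamma>_eq: "\<gamma>' * d * d = \<beta> * (\<gamma>' * d * b - (a * b + \<gamma>' * b * b)) + \<gamma> * (a * d + \<gamma>' * b * d)"
    using vv'[of "n + 3"] unfolding brvv e_n e_n2' e_n3' by simp
  define c where "c = (u (n - 1) - v (n - 1)) * a"
  have \<alpha>_eq: "\<alpha>' * d * d = \<alpha> * (a ^ (n - 1) * d) + \<beta> * (\<alpha>' * d * b - \<alpha>' * b * b - c)
      + \<gamma> * (\<alpha>' * b * d)"
    using vv'[of n] unfolding brvv e_n e_n2' e_n3' c_def by (simp add: algebra_simps)
  define t where "t = d / a"
  have dt: "d = a * t" and bt: "b = a * (t - 1)"
    using a dab by (auto simp: t_def field_simps)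
  have an: "a ^ (n - 1) = a * a ^ (n - 2)"
  proof -
    have "n - 1 = Suc (n - 2)" using n by linarith
    then show ?thesis by simp
  qed
  let ?k = "t\<^sup>2 - \<beta> * (t - 1) - \<gamma> * t * (t - 1)"
  have a2: "a\<^sup>2 \<noteq> 0" using a by simp
  have "a\<^sup>2 * (?k * \<beta>') = a\<^sup>2 * \<beta>"
    using \<beta>_eq unfolding dt bt by (simp add: power2_eq_square algebra_simps)
  moreover have "a\<^sup>2 * (?k * \<gamma>') = a\<^sup>2 * (\<gamma> * t - \<beta> * (t - 1))"
    using \<gamma>_eq unfolding dt bt by (simp add: power2_eq_square algebra_simps)
  moreover have "a\<^sup>2 * (?k * \<alpha>') = a\<^sup>2 * (\<alpha> * t * a ^ (n - 2) - \<beta> * (c / a\<^sup>2))"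
    using \<alpha>_eq a unfolding dt bt an by (simp add: power2_eq_square algebra_simps)
  ultimately show thesis
    using a2 a d dt by (intro that[of a t ?k "c / a\<^sup>2"]) auto
qed

lemma P_params_cases:
  assumes "(\<alpha>, \<beta>, \<gamma>) \<in> P_params"
  shows "\<beta> = 0 \<and> (\<alpha> = 0 \<or> \<alpha> = 1) \<and> (\<gamma> = 0 \<or> \<gamma> = 1 \<or> \<gamma> = 2) \<or>
    \<alpha> = 0 \<and> (\<beta> = 1 \<or> \<beta> = 2 \<and> (\<gamma> = 1 \<or> \<gamma> = 2))"
  using assms unfolding P_params_def Un_iff insert_iff empty_iff mem_Collect_eq prod.inject
  by (elim disjE exE conjE) simp_all

text \<open>
  As \<open>k \<noteq> 0\<close>, the vanishing of \<open>\<beta>\<close> and of \<open>\<gamma> - \<beta>\<close> are invariants. If \<open>\<beta> = 0\<close>, so are the vanishing of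
  \<open>\<alpha>\<close> and of \<open>\<gamma>\<close> and the condition \<open>\<gamma> = 1\<close>. In the remaining cases the equations with
  \<open>\<beta>, \<beta>' \<in> {1, 2}\<close> either force \<open>t = 0\<close> or make both triples equal.
\<close>

lemma P_params_not_isomorphic:
  assumes n: "3 \<le> n" and p: "(\<alpha>, \<beta>, \<gamma>) \<in> P_params" "(\<alpha>', \<beta>', \<gamma>') \<in> P_params"
    and iso: "P n \<alpha> \<beta> \<gamma> \<cong>\<^sub>a P n \<alpha>' \<beta>' \<gamma>'"
  shows "(\<alpha>, \<beta>, \<gamma>) = (\<alpha>', \<beta>', \<gamma>')"
proof -
  obtain a t k c where at: "a \<noteq> 0" "t \<noteq> 0" and k: "k = t\<^sup>2 - \<beta> * (t - 1) - \<gamma> * t * (t - 1)"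
    and \<alpha>: "k * \<alpha>' = \<alpha> * t * a ^ (n - 2) - \<beta> * c" and \<beta>: "k * \<beta>' = \<beta>"
    and \<gamma>: "k * \<gamma>' = \<gamma> * t - \<beta> * (t - 1)"
    by (rule P_isomorphic_params[OF n iso])
  have k0: "k \<noteq> 0"
  proof
    assume "k = 0"
    then have "\<beta> = 0" "\<gamma> = 0" using \<beta> \<gamma> at by auto
    then show False using k \<open>k = 0\<close> at by simp
  qed
  have \<beta>0: "\<beta> = 0 \<longleftrightarrow> \<beta>' = 0" using \<beta> k0 by auto
  show ?thesis
  proof (cases "\<beta> = 0")
    case True
    have \<alpha>0: "\<alpha> = 0 \<longleftrightarrow> \<alpha>' = 0" and \<gamma>0: "\<gamma> = 0 \<longleftrightarrow> \<gamma>' = 0"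
      using \<alpha> \<gamma> k0 at True by auto
    have \<gamma>1: "\<gamma> = 1 \<Longrightarrow> \<gamma>' = 1"
      using \<gamma> k True at by (simp add: power2_eq_square algebra_simps)
    have \<gamma>'1: "\<gamma> = 1" if "\<gamma>' = 1"
    proof -
      have "k = \<gamma> * t" using \<gamma> True that by simp
      then have "t * (t * (1 - \<gamma>)) = 0"
        using k True by (simp add: power2_eq_square algebra_simps)
      then show "\<gamma> = 1" using at by simp
    qed
    have "\<beta>' = 0" using True \<beta>0 by simp
    have "\<alpha> = 0 \<or> \<alpha> = 1" "\<alpha>' = 0 \<or> \<alpha>' = 1"
      using P_params_cases[OF p(1)] P_params_cases[OF p(2)] True \<open>\<beta>' = 0\<close> by simp_all
    then have "\<alpha> = \<alpha>'" using \<alpha>0 by (elim disjE) simp_all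
    have "\<gamma> = 0 \<or> \<gamma> = 1 \<or> \<gamma> = 2" "\<gamma>' = 0 \<or> \<gamma>' = 1 \<or> \<gamma>' = 2"
      using P_params_cases[OF p(1)] P_params_cases[OF p(2)] True \<open>\<beta>' = 0\<close> by simp_all
    then have "\<gamma> = \<gamma>'" using \<gamma>0 \<gamma>1 \<gamma>'1 by (elim disjE) simp_all
    show ?thesis using True \<open>\<beta>' = 0\<close> \<open>\<alpha> = \<alpha>'\<close> \<open>\<gamma> = \<gamma>'\<close> by simp
  next
    case False
    have diff: "k * (\<gamma>' - \<beta>') = t * (\<gamma> - \<beta>)"
    proof -
      have "k * (\<gamma>' - \<beta>') = k * \<gamma>' - k * \<beta>'" by (rule right_diff_distrib)
      also have "\<dots> = (\<gamma> * t - \<beta> * (t - 1)) - \<beta>" by (simp only: \<beta> \<gamma>)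
      also have "\<dots> = t * (\<gamma> - \<beta>)" by (simp add: algebra_simps)
      finally show ?thesis .
    qed
    have eq: "\<gamma> = \<beta> \<longleftrightarrow> \<gamma>' = \<beta>'"
      using diff k0 at by (metis mult_eq_0_iff right_minus_eq)
    show ?thesis
    proof (cases "\<gamma> = \<beta>")
      case True
      have k': "k = t\<^sup>2 - \<beta> * (t\<^sup>2 - 1)"
        using k True by (simp add: power2_eq_square algebra_simps)
      have "\<beta> = 1 \<or> \<beta> = 2" "\<beta>' = 1 \<or> \<beta>' = 2" "\<alpha> = 0" "\<alpha>' = 0"
        using P_params_cases[OF p(1)] P_params_cases[OF p(2)] False \<beta>0 by blast+
      moreover have "\<beta>' = 1" if "\<beta> = 1" using that k' \<beta> by simp
      moreover have "\<beta>' \<noteq> 1" if "\<beta> = 2"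
      proof
        assume "\<beta>' = 1"
        then have "2 = t\<^sup>2 - 2 * (t\<^sup>2 - 1)" using \<beta> k' that by simp
        then have "t\<^sup>2 = 0" by (simp add: algebra_simps)
        then show False using at by simp
      qed
      ultimately show ?thesis using True eq by auto
    next
      case neq: False
      then have neq': "\<gamma>' \<noteq> \<beta>'" using eq by simp
      have 0: "\<alpha> = 0" "\<alpha>' = 0" and one: "\<beta> = 1 \<and> \<gamma> \<noteq> 1 \<or> \<beta> = 2 \<and> \<gamma> = 1"
        and one': "\<beta>' = 1 \<and> \<gamma>' \<noteq> 1 \<or> \<beta>' = 2 \<and> \<gamma>' = 1"
        using P_params_cases[OF p(1)] P_params_cases[OF p(2)] False \<beta>0 neq neq' by metis+
      from one show ?thesis
      proof
        assume b: "\<beta> = 1 \<and> \<gamma> \<noteq> 1"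
        from one' show ?thesis
        proof
          assume b': "\<beta>' = 1 \<and> \<gamma>' \<noteq> 1"
          then have "(t - 1) * t * (1 - \<gamma>) = 0"
            using b k \<beta> by (simp add: power2_eq_square algebra_simps)
          then have "t = 1" using at b by simp
          then show ?thesis using b b' \<beta> \<gamma> 0 by simp
        next
          assume b': "\<beta>' = 2 \<and> \<gamma>' = 1"
          define h where "h = (1 - \<gamma>) * t"
          have h: "k = 1 - h" "k = 1 + h * (t - 1)"
            using b b' \<gamma> k by (simp_all add: h_def power2_eq_square algebra_simps)
          then have "h * t = 0" by (simp add: algebra_simps)
          then show ?thesis using at b by (simp add: h_def)
        qed
      next
        assume b: "\<beta> = 2 \<and> \<gamma> = 1"
        have "k = 2 - t" using b k by (simp add: power2_eq_square algebra_simps)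
        moreover have "k * \<gamma>' = 2 - t" using b \<gamma> by (simp add: algebra_simps)
        ultimately have "\<gamma>' = 1" using k0 by simp
        then show ?thesis using one' b 0 by auto
      qed
    qed
  qed
qed

section \<open>The classification\<close>

theorem theorem4p6:
  fixes n :: nat
  assumes "n \<ge> 3"
  shows "(\<forall>E :: ('a::ab_group_add) calg. non_split_extension 3 E (F1 n) \<longrightarrow>
            (\<exists>(\<alpha>, \<beta>, \<gamma>) \<in> P_params. E \<cong>\<^sub>a P n \<alpha> \<beta> \<gamma>) \<or> E \<cong>\<^sub>a Pstar n)
       \<and> (\<forall>(\<alpha>, \<beta>, \<gamma>) \<in> P_params. \<forall>(\<alpha>', \<beta>', \<gamma>') \<in> P_params.
            (\<alpha>, \<beta>, \<gamma>) \<noteq> (\<alpha>', \<beta>', \<gamma>') \<longrightarrow> \<not> P n \<alpha> \<beta> \<gamma> \<cong>\<^sub>a P n \<alpha>' \<beta>' \<gamma>')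
       \<and> (\<forall>(\<alpha>, \<beta>, \<gamma>) \<in> P_params. \<not> P n \<alpha> \<beta> \<gamma> \<cong>\<^sub>a Pstar n)"
proof (intro conjI)
  show "\<forall>E :: 'a calg. non_split_extension 3 E (F1 n) \<longrightarrow>
      (\<exists>(\<alpha>, \<beta>, \<gamma>) \<in> P_params. E \<cong>\<^sub>a P n \<alpha> \<beta> \<gamma>) \<or> E \<cong>\<^sub>a Pstar n"
    using non_split_extension_classification[OF assms] by blast
  show "\<forall>(\<alpha>, \<beta>, \<gamma>) \<in> P_params. \<forall>(\<alpha>', \<beta>', \<gamma>') \<in> P_params.
      (\<alpha>, \<beta>, \<gamma>) \<noteq> (\<alpha>', \<beta>', \<gamma>') \<longrightarrow> \<not> P n \<alpha> \<beta> \<gamma> \<cong>\<^sub>a P n \<alpha>' \<beta>' \<gamma>'"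
    using P_params_not_isomorphic[OF assms] by blast
  show "\<forall>(\<alpha>, \<beta>, \<gamma>) \<in> P_params. \<not> P n \<alpha> \<beta> \<gamma> \<cong>\<^sub>a Pstar n"
    using P_not_isomorphic_Pstar[OF assms] by blast
qed

end
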